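(* Any Courant-Nijenhuis tensor $N$ on an irreducible Courant algebroid $A$ satisfies (a) $N+N^*=\lambda I$, (b) $N^2-\lambda N+\gamma I=0$, for certain $\lambda,\gamma\in\mathbb{R}$, so that the algebra with involution generated by $N$, thus the corresponding hierarchy, is trivial.
   Context: A Courant algebroid is a vector bundle $A\to M$ with (i) an $\mathbb{R}$-bilinear product $\circ$ on $\mathrm{Sec}(A)$ that is Leibniz, i.e. $(X\circ Y)\circ Z=X\circ(Y\circ Z)-Y\circ(X\circ Z)$; (ii) a vector bundle map $\rho:A\to \mathrm{T}M$ over the identity; (iii) a nondegenerate symmetric bilinear form $\langle\cdot,\cdot\rangle$ on $A$ (fibrewise), satisfying for all sections $$\rho(X)\langle Y,Y\rangle=2\langle X,Y\circ Y\rangle,\qquad \rho(X)\langle Y,Y\rangle=2\langle X\circ Y,Y\rangle.\qquad ( * )$$ A $(1,1)$-tensor on $A$ is a vector bundle morphism $N:A\to A$ over the identity, also viewed as a $C^\infty(M)$-linear map on sections; $N^*$ is its adjoint, $\langle NX,Y\rangle=\langle X,N^*Y\rangle$, and $N^2$ is the composition of $N$ with itself. The contracted product is $X\circ_N Y=N(X)\circ Y+X\circ N(Y)-N(X\circ Y)$, and the Nijenhuis torsion is $\mathrm{Tor}_N(X,Y)=N(X)\circ N(Y)-N(X\circ_N Y)$. $N$ is a Nijenhuis tensor if $\mathrm{Tor}_N=0$. $N$ is a Courant-Nijenhuis tensor if it is a Nijenhuis tensor and is compatible with the pairing, meaning that the identities $( * )$ hold with $\circ$ replaced by $\circ_N$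 and $\rho$ replaced by the composition $\rho_N$ of $N$ followed by $\rho$, with the same pairing. A Courant algebroid is irreducible if the maps $\lambda I$, $\lambda\in\mathbb{R}$, are the only $(1,1)$-tensors $\Delta:A\to A$ satisfying $X\circ\Delta Z=\Delta(X\circ Z)$ and $\Delta(Y\circ Y)=(\Delta Y)\circ Y$ for all sections $X,Y,Z$. In the last clause of the claim, the involution is the adjoint $^*$ with respect to the pairing, and "hierarchy" has its usual meaning for Nijenhuis tensors: the family of powers of $N$ and of the associated contracted products. The word "trivial" is used informally, without a separate definition, to describe the consequence of the relations (a) and (b). *)

theory Defs
  imports "HOL-Analysis.Analysis"
begin

section \<open>Smooth maps and manifolds\<close>

text \<open>Only used for open \<open>S\<close>. On a finite-dimensional domain, continuity of all directional
  derivatives \<open>\<lambda>x. Df(x) v\<close> is continuity of \<open>Df\<close>, so this is the usual class \<open>C\<^sup>k\<close>.\<close>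

primrec ck_on :: "nat \<Rightarrow> 'a::real_normed_vector set \<Rightarrow> ('a \<Rightarrow> 'b::real_normed_vector) \<Rightarrow> bool" where
  "ck_on 0 S f \<longleftrightarrow> continuous_on S f"
| "ck_on (Suc k) S f \<longleftrightarrow> (\<forall>x\<in>S. f differentiable (at x)) \<and>
     (\<forall>v. ck_on k S (\<lambda>x. frechet_derivative f (at x) v))"

definition smooth_on :: "'a::real_normed_vector set \<Rightarrow> ('a \<Rightarrow> 'b::real_normed_vector) \<Rightarrow> bool" where
  "smooth_on S f \<longleftrightarrow> (\<forall>k. ck_on k S f)"

record ('m, 'e) manifold =
  atlas :: "('m set \<times> ('m \<Rightarrow> 'e)) set"

text \<open>The manifold is the whole type \<open>'m\<close>. The model space is an arbitrary finite-dimensional inner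
  product space rather than an instance of class \<open>euclidean_space\<close>, because the latter has positive
  dimension and zero-dimensional manifolds must not be excluded.\<close>

definition smooth_manifold ::
  "('m::{t2_space,second_countable_topology}, 'e::real_inner, 'z) manifold_scheme \<Rightarrow> bool" where
  "smooth_manifold M \<longleftrightarrow>
     (\<exists>B::'e set. finite B \<and> span B = UNIV) \<and>
     (\<forall>(U, \<phi>) \<in> atlas M. open U \<and> open (\<phi> ` U) \<and> (\<exists>\<psi>. homeomorphism U (\<phi> ` U) \<phi> \<psi>)) \<and>
     (\<Union>(U, \<phi>) \<in> atlas M. U) = UNIV \<and>
     (\<forall>(U, \<phi>) \<in> atlas M. \<forall>(V, \<psi>) \<in> atlas M. smooth_on (\<phi> ` (U \<inter> V)) (\<psi> \<circ> inv_into U \<phi>))"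

definition smooth_fun_on :: "('m, 'e::real_inner, 'z) manifold_scheme \<Rightarrow> 'm set \<Rightarrow> ('m \<Rightarrow> real) \<Rightarrow> bool" where
  "smooth_fun_on M W f \<longleftrightarrow> (\<forall>(U, \<phi>) \<in> atlas M. smooth_on (\<phi> ` (U \<inter> W)) (f \<circ> inv_into U \<phi>))"

definition smooth_funs :: "('m, 'e::real_inner, 'z) manifold_scheme \<Rightarrow> ('m \<Rightarrow> real) set" where
  "smooth_funs M = {f. smooth_fun_on M UNIV f}"

text \<open>Tangent vectors at \<open>p\<close> are the derivations at \<open>p\<close> of the algebra of smooth functions.\<close>

definition tangent_space ::
  "('m, 'e::real_inner, 'z) manifold_scheme \<Rightarrow> 'm \<Rightarrow> (('m \<Rightarrow> real) \<Rightarrow> real) set" where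
  "tangent_space M p = {D \<in> extensional (smooth_funs M).
     (\<forall>f\<in>smooth_funs M. \<forall>h\<in>smooth_funs M. D (\<lambda>q. f q + h q) = D f + D h) \<and>
     (\<forall>f\<in>smooth_funs M. \<forall>c. D (\<lambda>q. c * f q) = c * D f) \<and>
     (\<forall>f\<in>smooth_funs M. \<forall>h\<in>smooth_funs M. D (\<lambda>q. f q * h q) = D f * h p + f p * D h)}"


section \<open>Vector bundles\<close>

text \<open>The fibres are subspaces of a common ambient real vector space \<open>'v\<close>, which can be any
  (possibly infinite-dimensional) space, e.g. the direct sum of the fibres of an abstractly given
  bundle; no compatibility between \<open>'v\<close> and the smooth structure is assumed. The smooth structure of
  the total space is given by local frames, i.e. local trivialisations, indexed by
  \<open>{..<bundle_rank A}\<close>, with smooth transition matrices.\<close>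

record ('m, 'e, 'v) vbundle = "('m, 'e) manifold" +
  bundle_rank :: nat
  fibre :: "'m \<Rightarrow> 'v set"
  frames :: "('m set \<times> (nat \<Rightarrow> 'm \<Rightarrow> 'v)) set"

definition smooth_in_frame ::
  "('m, 'e::real_inner, 'v::real_vector, 'z) vbundle_scheme \<Rightarrow> 'm set \<Rightarrow> (nat \<Rightarrow> 'm \<Rightarrow> 'v) \<Rightarrow> ('m \<Rightarrow> 'v) \<Rightarrow> bool"
  where
  "smooth_in_frame A W e X \<longleftrightarrow>
     (\<exists>c. (\<forall>i<bundle_rank A. smooth_fun_on A W (c i)) \<and>
          (\<forall>p\<in>W. X p = (\<Sum>i<bundle_rank A. c i p *\<^sub>R e i p)))"

definition vector_bundle ::
  "('m::{t2_space,second_countable_topology}, 'e::real_inner, 'v::real_vector, 'z) vbundle_scheme \<Rightarrow> bool"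
  where
  "vector_bundle A \<longleftrightarrow>
     smooth_manifold A \<and>
     (\<Union>(U, e) \<in> frames A. U) = UNIV \<and>
     (\<forall>(U, e) \<in> frames A. open U \<and>
        (\<forall>p\<in>U. inj_on (\<lambda>i. e i p) {..<bundle_rank A} \<and>
               independent ((\<lambda>i. e i p) ` {..<bundle_rank A}) \<and>
               span ((\<lambda>i. e i p) ` {..<bundle_rank A}) = fibre A p)) \<and>
     (\<forall>(U, e) \<in> frames A. \<forall>(V, e') \<in> frames A. \<forall>j<bundle_rank A.
        smooth_in_frame A (U \<inter> V) e (e' j))"

definition Sec :: "('m, 'e::real_inner, 'v::real_vector, 'z) vbundle_scheme \<Rightarrow> ('m \<Rightarrow> 'v) set" where
  "Sec A = {X. (\<forall>p. X p \<in> fibre A p) \<and> (\<forall>(U, e) \<in> frames A. smooth_in_frame A U e X)}"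


section \<open>(1,1)-tensors\<close>

text \<open>Bundle endomorphisms are made extensional on each fibre, so that equality of tensors is
  equality in the logic.\<close>

definition tensor11 ::
  "('m, 'e::real_inner, 'v::real_vector, 'z) vbundle_scheme \<Rightarrow> ('m \<Rightarrow> 'v \<Rightarrow> 'v) \<Rightarrow> bool" where
  "tensor11 A N \<longleftrightarrow>
     (\<forall>p. N p \<in> fibre A p \<rightarrow>\<^sub>E fibre A p) \<and>
     (\<forall>p. \<forall>u\<in>fibre A p. \<forall>v\<in>fibre A p. N p (u + v) = N p u + N p v) \<and>
     (\<forall>p. \<forall>u\<in>fibre A p. \<forall>c. N p (c *\<^sub>R u) = c *\<^sub>R N p u) \<and>
     (\<forall>(U, e) \<in> frames A. \<forall>j<bundle_rank A. smooth_in_frame A U e (\<lambda>p. N p (e j p)))"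

definition tens_id :: "('m, 'e, 'v, 'z) vbundle_scheme \<Rightarrow> 'm \<Rightarrow> 'v \<Rightarrow> 'v" where
  "tens_id A = (\<lambda>p. \<lambda>v\<in>fibre A p. v)"

definition tens_zero :: "('m, 'e, 'v::real_vector, 'z) vbundle_scheme \<Rightarrow> 'm \<Rightarrow> 'v \<Rightarrow> 'v" where
  "tens_zero A = (\<lambda>p. \<lambda>v\<in>fibre A p. 0)"

definition tens_add ::
  "('m, 'e, 'v::real_vector, 'z) vbundle_scheme \<Rightarrow> ('m \<Rightarrow> 'v \<Rightarrow> 'v) \<Rightarrow> ('m \<Rightarrow> 'v \<Rightarrow> 'v) \<Rightarrow> 'm \<Rightarrow> 'v \<Rightarrow> 'v" where
  "tens_add A S T = (\<lambda>p. \<lambda>v\<in>fibre A p. S p v + T p v)"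

definition tens_scale ::
  "('m, 'e, 'v::real_vector, 'z) vbundle_scheme \<Rightarrow> real \<Rightarrow> ('m \<Rightarrow> 'v \<Rightarrow> 'v) \<Rightarrow> 'm \<Rightarrow> 'v \<Rightarrow> 'v" where
  "tens_scale A c T = (\<lambda>p. \<lambda>v\<in>fibre A p. c *\<^sub>R T p v)"

definition tens_comp ::
  "('m, 'e, 'v, 'z) vbundle_scheme \<Rightarrow> ('m \<Rightarrow> 'v \<Rightarrow> 'v) \<Rightarrow> ('m \<Rightarrow> 'v \<Rightarrow> 'v) \<Rightarrow> 'm \<Rightarrow> 'v \<Rightarrow> 'v" where
  "tens_comp A S T = (\<lambda>p. compose (fibre A p) (S p) (T p))"

primrec tens_power ::
  "('m, 'e, 'v, 'z) vbundle_scheme \<Rightarrow> ('m \<Rightarrow> 'v \<Rightarrow> 'v) \<Rightarrow> nat \<Rightarrow> 'm \<Rightarrow> 'v \<Rightarrow> 'v" where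
  "tens_power A N 0 = tens_id A"
| "tens_power A N (Suc k) = tens_comp A N (tens_power A N k)"

definition tens_app :: "('m \<Rightarrow> 'v \<Rightarrow> 'v) \<Rightarrow> ('m \<Rightarrow> 'v) \<Rightarrow> 'm \<Rightarrow> 'v" where
  "tens_app N X = (\<lambda>p. N p (X p))"


section \<open>Courant algebroids\<close>

record ('m, 'e, 'v) courant = "('m, 'e, 'v) vbundle" +
  cprod :: "('m \<Rightarrow> 'v) \<Rightarrow> ('m \<Rightarrow> 'v) \<Rightarrow> 'm \<Rightarrow> 'v"
  anchor :: "'m \<Rightarrow> 'v \<Rightarrow> ('m \<Rightarrow> real) \<Rightarrow> real"
  pairing :: "'m \<Rightarrow> 'v \<Rightarrow> 'v \<Rightarrow> real"

definition leibniz_product ::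
  "('m, 'e::real_inner, 'v::real_vector, 'z) vbundle_scheme \<Rightarrow>
   (('m \<Rightarrow> 'v) \<Rightarrow> ('m \<Rightarrow> 'v) \<Rightarrow> 'm \<Rightarrow> 'v) \<Rightarrow> bool" where
  "leibniz_product A pr \<longleftrightarrow>
     (\<forall>X\<in>Sec A. \<forall>Y\<in>Sec A. pr X Y \<in> Sec A) \<and>
     (\<forall>X\<in>Sec A. \<forall>Y\<in>Sec A. \<forall>Z\<in>Sec A.
        pr (\<lambda>p. X p + Y p) Z = (\<lambda>p. pr X Z p + pr Y Z p) \<and>
        pr Z (\<lambda>p. X p + Y p) = (\<lambda>p. pr Z X p + pr Z Y p)) \<and>
     (\<forall>X\<in>Sec A. \<forall>Y\<in>Sec A. \<forall>c::real.
        pr (\<lambda>p. c *\<^sub>R X p) Y = (\<lambda>p. c *\<^sub>R pr X Y p) \<and>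
        pr X (\<lambda>p. c *\<^sub>R Y p) = (\<lambda>p. c *\<^sub>R pr X Y p)) \<and>
     (\<forall>X\<in>Sec A. \<forall>Y\<in>Sec A. \<forall>Z\<in>Sec A.
        pr (pr X Y) Z = (\<lambda>p. pr X (pr Y Z) p - pr Y (pr X Z) p))"

text \<open>A fibrewise linear map \<open>\<rho>\<close> into the tangent spaces is smooth iff it sends the elements of local
  frames to smooth vector fields; a vector field is smooth iff it maps smooth functions to smooth
  functions.\<close>

definition bundle_map_to_tangent ::
  "('m, 'e::real_inner, 'v::real_vector, 'z) vbundle_scheme \<Rightarrow>
   ('m \<Rightarrow> 'v \<Rightarrow> ('m \<Rightarrow> real) \<Rightarrow> real) \<Rightarrow> bool" where
  "bundle_map_to_tangent A \<rho> \<longleftrightarrow>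
     (\<forall>p. \<forall>v\<in>fibre A p. \<rho> p v \<in> tangent_space A p) \<and>
     (\<forall>p. \<forall>u\<in>fibre A p. \<forall>v\<in>fibre A p. \<forall>f\<in>smooth_funs A. \<rho> p (u + v) f = \<rho> p u f + \<rho> p v f) \<and>
     (\<forall>p. \<forall>v\<in>fibre A p. \<forall>c. \<forall>f\<in>smooth_funs A. \<rho> p (c *\<^sub>R v) f = c * \<rho> p v f) \<and>
     (\<forall>(U, e) \<in> frames A. \<forall>j<bundle_rank A. \<forall>f\<in>smooth_funs A.
        smooth_fun_on A U (\<lambda>p. \<rho> p (e j p) f))"

definition nondegenerate_metric ::
  "('m, 'e::real_inner, 'v::real_vector, 'z) vbundle_scheme \<Rightarrow> ('m \<Rightarrow> 'v \<Rightarrow> 'v \<Rightarrow> real) \<Rightarrow> bool" where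
  "nondegenerate_metric A g \<longleftrightarrow>
     (\<forall>p. \<forall>u\<in>fibre A p. \<forall>v\<in>fibre A p. g p u v = g p v u) \<and>
     (\<forall>p. \<forall>u\<in>fibre A p. \<forall>v\<in>fibre A p. \<forall>w\<in>fibre A p. g p (u + v) w = g p u w + g p v w) \<and>
     (\<forall>p. \<forall>u\<in>fibre A p. \<forall>v\<in>fibre A p. \<forall>c. g p (c *\<^sub>R u) v = c * g p u v) \<and>
     (\<forall>p. \<forall>u\<in>fibre A p. (\<forall>v\<in>fibre A p. g p u v = 0) \<longrightarrow> u = 0) \<and>
     (\<forall>(U, e) \<in> frames A. \<forall>i<bundle_rank A. \<forall>j<bundle_rank A.
        smooth_fun_on A U (\<lambda>p. g p (e i p) (e j p)))"

text \<open>The two identities \<open>\<rho>(X)\<langle>Y,Y\<rangle> = 2\<langle>X, Y \<circ> Y\<rangle>\<close> and \<open>\<rho>(X)\<langle>Y,Y\<rangle> = 2\<langle>X \<circ> Y, Y\<rangle>\<close>, for an arbitrary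
  product \<open>pr\<close> and anchor \<open>\<rho>\<close>.\<close>

definition pairing_compatible ::
  "('m, 'e::real_inner, 'v::real_vector, 'z) courant_scheme \<Rightarrow>
   (('m \<Rightarrow> 'v) \<Rightarrow> ('m \<Rightarrow> 'v) \<Rightarrow> 'm \<Rightarrow> 'v) \<Rightarrow> ('m \<Rightarrow> 'v \<Rightarrow> ('m \<Rightarrow> real) \<Rightarrow> real) \<Rightarrow> bool" where
  "pairing_compatible A pr \<rho> \<longleftrightarrow>
     (\<forall>X\<in>Sec A. \<forall>Y\<in>Sec A. \<forall>p.
        \<rho> p (X p) (\<lambda>q. pairing A q (Y q) (Y q)) = 2 * pairing A p (X p) (pr Y Y p) \<and>
        \<rho> p (X p) (\<lambda>q. pairing A q (Y q) (Y q)) = 2 * pairing A p (pr X Y p) (Y p))"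

definition courant_algebroid ::
  "('m::{t2_space,second_countable_topology}, 'e::real_inner, 'v::real_vector, 'z) courant_scheme \<Rightarrow> bool"
  where
  "courant_algebroid A \<longleftrightarrow>
     vector_bundle A \<and>
     leibniz_product A (cprod A) \<and>
     bundle_map_to_tangent A (anchor A) \<and>
     nondegenerate_metric A (pairing A) \<and>
     pairing_compatible A (cprod A) (anchor A)"

definition adjoint_tensor ::
  "('m, 'e, 'v, 'z) courant_scheme \<Rightarrow> ('m \<Rightarrow> 'v \<Rightarrow> 'v) \<Rightarrow> 'm \<Rightarrow> 'v \<Rightarrow> 'v" where
  "adjoint_tensor A N = (\<lambda>p. \<lambda>v\<in>fibre A p.
     THE w. w \<in> fibre A p \<and> (\<forall>u\<in>fibre A p. pairing A p (N p u) v = pairing A p u w))"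

definition contracted ::
  "('m, 'e, 'v::real_vector, 'z) courant_scheme \<Rightarrow> ('m \<Rightarrow> 'v \<Rightarrow> 'v) \<Rightarrow>
   ('m \<Rightarrow> 'v) \<Rightarrow> ('m \<Rightarrow> 'v) \<Rightarrow> 'm \<Rightarrow> 'v" where
  "contracted A N X Y =
     (\<lambda>p. cprod A (tens_app N X) Y p + cprod A X (tens_app N Y) p - tens_app N (cprod A X Y) p)"

definition torsion ::
  "('m, 'e, 'v::real_vector, 'z) courant_scheme \<Rightarrow> ('m \<Rightarrow> 'v \<Rightarrow> 'v) \<Rightarrow>
   ('m \<Rightarrow> 'v) \<Rightarrow> ('m \<Rightarrow> 'v) \<Rightarrow> 'm \<Rightarrow> 'v" where
  "torsion A N X Y =
     (\<lambda>p. cprod A (tens_app N X) (tens_app N Y) p - tens_app N (contracted A N X Y) p)"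

definition nijenhuis_tensor ::
  "('m, 'e::real_inner, 'v::real_vector, 'z) courant_scheme \<Rightarrow> ('m \<Rightarrow> 'v \<Rightarrow> 'v) \<Rightarrow> bool" where
  "nijenhuis_tensor A N \<longleftrightarrow>
     tensor11 A N \<and> (\<forall>X\<in>Sec A. \<forall>Y\<in>Sec A. torsion A N X Y = (\<lambda>p. 0))"

definition courant_nijenhuis_tensor ::
  "('m, 'e::real_inner, 'v::real_vector, 'z) courant_scheme \<Rightarrow> ('m \<Rightarrow> 'v \<Rightarrow> 'v) \<Rightarrow> bool" where
  "courant_nijenhuis_tensor A N \<longleftrightarrow>
     nijenhuis_tensor A N \<and>
     pairing_compatible A (contracted A N) (\<lambda>p v. anchor A p (N p v))"

definition irreducible_courant ::
  "('m, 'e::real_inner, 'v::real_vector, 'z) courant_scheme \<Rightarrow> bool" where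
  "irreducible_courant A \<longleftrightarrow>
     {\<Delta>. tensor11 A \<Delta> \<and>
         (\<forall>X\<in>Sec A. \<forall>Z\<in>Sec A. cprod A X (tens_app \<Delta> Z) = tens_app \<Delta> (cprod A X Z)) \<and>
         (\<forall>Y\<in>Sec A. tens_app \<Delta> (cprod A Y Y) = cprod A (tens_app \<Delta> Y) Y)}
     = {tens_scale A l (tens_id A) | l. True}"

text \<open>The unital real algebra of (1,1)-tensors, closed under the adjoint, generated by \<open>N\<close>.\<close>

inductive_set involutive_algebra ::
  "('m, 'e, 'v::real_vector, 'z) courant_scheme \<Rightarrow> ('m \<Rightarrow> 'v \<Rightarrow> 'v) \<Rightarrow> ('m \<Rightarrow> 'v \<Rightarrow> 'v) set"
  for A :: "('m, 'e, 'v::real_vector, 'z) courant_scheme" and N :: "'m \<Rightarrow> 'v \<Rightarrow> 'v" where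
  gen_id: "tens_id A \<in> involutive_algebra A N"
| gen_N: "N \<in> involutive_algebra A N"
| gen_add: "S \<in> involutive_algebra A N \<Longrightarrow> T \<in> involutive_algebra A N
    \<Longrightarrow> tens_add A S T \<in> involutive_algebra A N"
| gen_scale: "T \<in> involutive_algebra A N \<Longrightarrow> tens_scale A c T \<in> involutive_algebra A N"
| gen_comp: "S \<in> involutive_algebra A N \<Longrightarrow> T \<in> involutive_algebra A N
    \<Longrightarrow> tens_comp A S T \<in> involutive_algebra A N"
| gen_adjoint: "T \<in> involutive_algebra A N \<Longrightarrow> adjoint_tensor A T \<in> involutive_algebra A N"

end

theory Submission
  imports Defs "Jordan_Normal_Form.Determinant"
begin

text \<open>Put \<open>C\<^bsub>X\<^esub> = [X \<circ> _, N]\<close>. Compatibility with the pairing says that \<open>C\<^bsub>X\<^esub>\<close> is skew-symmetric and that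
  \<open>N\<^sup>*(Y \<circ> Y) = Y \<circ>\<^bsub>N\<^esub> Y\<close>; hence \<open>\<Delta> = N + N\<^sup>*\<close> satisfies \<open>X \<circ> \<Delta>Z = \<Delta>(X \<circ> Z)\<close> and
  \<open>\<Delta>(Y \<circ> Y) = \<Delta>Y \<circ> Y\<close>, and irreducibility gives \<open>\<Delta> = \<lambda>I\<close>. Vanishing torsion means
  \<open>C\<^bsub>NX\<^esub> = N C\<^bsub>X\<^esub>\<close>; as this is again skew, \<open>N C\<^bsub>X\<^esub> = C\<^bsub>X\<^esub> N\<^sup>*\<close>, which makes \<open>N\<^sup>2 - \<lambda>N = - N\<^sup>* N\<close> commute
  with \<open>X \<circ> _\<close>. Together with \<open>NY \<circ> NY = N N\<^sup>*(Y \<circ> Y)\<close> this allows a second use of irreducibility,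
  and \<open>N\<close> becomes quadratic over the scalars.

  Two facts from differential geometry enter: every vector of a fibre is the value of a global
  section (bump functions), and the adjoint of a smooth tensor is smooth (Cramer's rule for the
  Gram matrices of local frames).\<close>

section \<open>Smooth maps\<close>

lemma frechet_derivative_eqI:
  assumes "(f has_derivative f') (at x)"
  shows "frechet_derivative f (at x) = f'"
  by (rule frechet_derivative_at[symmetric]) (rule assms)

text \<open>Openness of \<open>S\<close> lets equality on \<open>S\<close> pass to derivatives: a
  derivative at \<open>x\<close> sees only values near \<open>x\<close>. This drives the induction
  on the order.\<close>

lemma ck_on_cong:
  assumes "open S" "\<And>x. x \<in> S \<Longrightarrow> f x = g x" "ck_on k S f"
  shows "ck_on k S g"
  using assms(2,3)
proof (induction k arbitrary: f g)
  case 0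
  then show ?case by (simp cong: continuous_on_cong)
next
  case (Suc k)
  have d: "(g has_derivative frechet_derivative f (at x)) (at x)" if "x \<in> S" for x
  proof (rule has_derivative_transform_within_open[OF _ assms(1) that])
    show "(f has_derivative frechet_derivative f (at x)) (at x)"
      using Suc.prems(2) that by (simp flip: frechet_derivative_works)
  qed (use Suc.prems in auto)
  have "ck_on k S (\<lambda>x. frechet_derivative g (at x) v)" for v
    by (rule Suc.IH[of "\<lambda>x. frechet_derivative f (at x) v"])
       (use Suc.prems(2) frechet_derivative_eqI[OF d] in auto)
  with d show ?case by (auto simp: differentiable_def)
qed

text \<open>Replaces the chosen \<open>frechet_derivative\<close> by any explicit formula
  \<open>f'\<close>, which is legitimate because derivatives are unique. All closure rules below go
  through it.\<close>

lemma ck_on_SucI: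
  assumes "open S" "\<And>x. x \<in> S \<Longrightarrow> (f has_derivative f' x) (at x)"
    "\<And>v. ck_on k S (\<lambda>x. f' x v)"
  shows "ck_on (Suc k) S f"
proof -
  have "ck_on k S (\<lambda>x. frechet_derivative f (at x) v)" for v
    by (rule ck_on_cong[OF assms(1) _ assms(3)[of v]])
       (simp add: frechet_derivative_eqI[OF assms(2)])
  then show ?thesis using assms(2) by (auto simp: differentiable_def)
qed

lemma ck_on_SucE:
  assumes "ck_on (Suc k) S f"
  obtains f' where "\<And>x. x \<in> S \<Longrightarrow> (f has_derivative f' x) (at x)"
    "\<And>v. ck_on k S (\<lambda>x. f' x v)"
proof (rule that)
  show "(f has_derivative frechet_derivative f (at x)) (at x)" if "x \<in> S" for x
    using assms that frechet_derivative_works by auto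
  show "ck_on k S (\<lambda>x. frechet_derivative f (at x) v)" for v
    using assms by simp
qed

lemma ck_on_Suc_imp: "ck_on (Suc k) S f \<Longrightarrow> ck_on k S f"
proof (induction k arbitrary: f)
  case 0
  then show ?case
    by (auto intro!: continuous_at_imp_continuous_on differentiable_imp_continuous_within)
qed auto

lemma ck_on_mono: "T \<subseteq> S \<Longrightarrow> ck_on k S f \<Longrightarrow> ck_on k T f"
  by (induction k arbitrary: f) (auto intro: continuous_on_subset)

lemma ck_on_local:
  assumes "\<And>x. x \<in> S \<Longrightarrow> \<exists>T. open T \<and> x \<in> T \<and> ck_on k T f"
  shows "ck_on k S f"
  using assms
proof (induction k arbitrary: f)
  case 0
  have "isCont f x" if "x \<in> S" for x
    using 0[OF that] by (auto simp: continuous_on_eq_continuous_at)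
  then show ?case by (simp add: continuous_at_imp_continuous_on)
next
  case (Suc k)
  have "ck_on k S (\<lambda>x. frechet_derivative f (at x) v)" for v
  proof (rule Suc.IH)
    fix x assume "x \<in> S"
    with Suc.prems obtain T where "open T" "x \<in> T" "ck_on (Suc k) T f" by blast
    then show "\<exists>T. open T \<and> x \<in> T \<and> ck_on k T (\<lambda>x. frechet_derivative f (at x) v)" by auto
  qed
  then show ?case using Suc.prems by auto
qed

lemma ck_on_const: "open S \<Longrightarrow> ck_on k S (\<lambda>x. c)"
proof (induction k arbitrary: c)
  case (Suc k)
  show ?case by (rule ck_on_SucI[OF Suc.prems, where f' = "\<lambda>x v. 0"]) (auto intro: Suc)
qed simp

lemma ck_on_add:
  assumes "open S" "ck_on k S f" "ck_on k S g"
  shows "ck_on k S (\<lambda>x. f x + g x)"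
  using assms(2,3)
proof (induction k arbitrary: f g)
  case (Suc k)
  obtain f' where f': "\<And>x. x \<in> S \<Longrightarrow> (f has_derivative f' x) (at x)" "\<And>v. ck_on k S (\<lambda>x. f' x v)"
    using Suc.prems(1) by (rule ck_on_SucE) (rule that)
  obtain g' where g': "\<And>x. x \<in> S \<Longrightarrow> (g has_derivative g' x) (at x)" "\<And>v. ck_on k S (\<lambda>x. g' x v)"
    using Suc.prems(2) by (rule ck_on_SucE) (rule that)
  show ?case
    by (rule ck_on_SucI[OF assms(1) has_derivative_add[OF f'(1) g'(1)] Suc.IH[OF f'(2) g'(2)]])
qed (auto intro: continuous_intros)

text \<open>One induction covers both real multiplication and the inner product of the model space.
  The product rule leaves one factor undifferentiated in each summand; \<open>ck_on_Suc_imp\<close>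
  lowers its order by one.\<close>

lemma (in bounded_bilinear) ck_on:
  assumes "open S" "ck_on k S f" "ck_on k S g"
  shows "ck_on k S (\<lambda>x. prod (f x) (g x))"
  using assms(2,3)
proof (induction k arbitrary: f g)
  case 0
  then show ?case by (auto intro: continuous_on)
next
  case (Suc k)
  obtain f' where f': "\<And>x. x \<in> S \<Longrightarrow> (f has_derivative f' x) (at x)" "\<And>v. ck_on k S (\<lambda>x. f' x v)"
    using Suc.prems(1) by (rule ck_on_SucE) (rule that)
  obtain g' where g': "\<And>x. x \<in> S \<Longrightarrow> (g has_derivative g' x) (at x)" "\<And>v. ck_on k S (\<lambda>x. g' x v)"
    using Suc.prems(2) by (rule ck_on_SucE) (rule that)
  show ?case
    by (rule ck_on_SucI[OF assms(1) FDERIV[OF f'(1) g'(1)] ck_on_add[OF assms(1)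
        Suc.IH[OF ck_on_Suc_imp[OF Suc.prems(1)] g'(2)] Suc.IH[OF f'(2) ck_on_Suc_imp[OF Suc.prems(2)]]]])
qed

lemmas ck_on_mult = bounded_bilinear.ck_on[OF bounded_bilinear_mult]

text \<open>The derivative of 1/f is again a product of 1/f, f' and 1/f up to sign, so the induction
  hypothesis applies to 1/f itself.\<close>

lemma ck_on_inverse:
  fixes f :: "'a::real_normed_vector \<Rightarrow> real"
  assumes "open S" "ck_on k S f" "\<And>x. x \<in> S \<Longrightarrow> f x \<noteq> 0"
  shows "ck_on k S (\<lambda>x. inverse (f x))"
  using assms(2)
proof (induction k)
  case 0
  then show ?case using assms(3) by (auto intro: continuous_intros)
next
  case (Suc k)
  obtain f' where f': "\<And>x. x \<in> S \<Longrightarrow> (f has_derivative f' x) (at x)" "\<And>v. ck_on k S (\<lambda>x. f' x v)"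
    using Suc.prems by (rule ck_on_SucE) (rule that)
  have "ck_on k S (\<lambda>x. - 1 * (inverse (f x) * f' x v * inverse (f x)))" for v
    by (intro ck_on_mult assms(1) ck_on_const Suc.IH f'(2) ck_on_Suc_imp[OF Suc.prems])
  then show ?case
    by (intro ck_on_SucI[OF assms(1) Deriv.has_derivative_inverse[OF assms(3) f'(1)]]) auto
qed

text \<open>The flat functions \<open>t\<^sup>-\<^sup>j exp(-1/t)\<close>, extended by zero to \<open>t \<le> 0\<close>; they span a space closed
  under differentiation.\<close>

definition flat :: "nat \<Rightarrow> real \<Rightarrow> real" where
  "flat j t = (if t > 0 then inverse t ^ j * exp (- inverse t) else 0)"

text \<open>This is the difference quotient of \<open>flat j\<close> at 0. On the right the
  substitution s = 1/t turns it into s^(j+1) / exp s at infinity; on the left it is identically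
  0.\<close>

lemma flat_div_tendsto_0: "((\<lambda>t. flat j t / t) \<longlongrightarrow> 0) (at 0)"
proof -
  have "((\<lambda>t::real. t ^ Suc j / exp t) \<longlongrightarrow> 0) at_top"
    by (rule tendsto_power_div_exp_0)
  then have "((\<lambda>t::real. inverse t ^ Suc j / exp (inverse t)) \<longlongrightarrow> 0) (at_right 0)"
    by (rule filterlim_compose[OF _ filterlim_inverse_at_top_right])
  moreover have "\<forall>\<^sub>F t in at_right 0. inverse t ^ Suc j / exp (inverse t) = flat j t / (t::real)"
    by (auto simp: eventually_at_right_field flat_def exp_minus divide_inverse intro!: exI[of _ 1])
  ultimately have "((\<lambda>t. flat j t / t) \<longlongrightarrow> 0) (at_right 0)"
    by (rule Lim_transform_eventually)
  moreover have "((\<lambda>t. flat j t / t) \<longlongrightarrow> 0) (at_left 0)"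
    by (rule tendsto_eventually) (auto simp: eventually_at_left_field flat_def intro!: exI[of _ "-1"])
  ultimately show ?thesis by (simp add: filterlim_at_split)
qed

text \<open>Away from 0 this is the product rule on the right and the zero function on the left. At
  0 the right-hand side vanishes, in agreement with \<open>flat_div_tendsto_0\<close>.\<close>

lemma has_real_derivative_flat:
  "(flat j has_real_derivative flat (j + 2) t - real j * flat (j + 1) t) (at t)"
proof -
  consider "t > 0" | "t < 0" | "t = 0" by linarith
  then show ?thesis
  proof cases
    case 1
    have inv: "(inverse has_real_derivative - (inverse t ^ 2)) (at t)"
      using 1 DERIV_inverse[of t] by (simp add: numeral_2_eq_2)
    \<comment> \<open>The case split on \<open>j\<close> deals with the truncated exponent
      \<open>j - 1\<close> in the power rule.\<close>
    have pow: "((\<lambda>t. inverse t ^ j) has_real_derivative - (real j * inverse t ^ (j + 1))) (at t)"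
      using DERIV_power[OF inv, of j] by (cases j) (auto simp: power2_eq_square algebra_simps)
    have "((\<lambda>t. inverse t ^ j * exp (- inverse t)) has_real_derivative
        flat (j + 2) t - real j * flat (j + 1) t) (at t)"
      by (rule DERIV_cong[OF DERIV_mult[OF pow DERIV_fun_exp[OF DERIV_minus[OF inv]]]])
         (use 1 in \<open>simp add: flat_def power2_eq_square algebra_simps\<close>)
    then show ?thesis
      by (rule has_field_derivative_transform_within_open[of _ _ _ "{0<..}"])
         (use 1 in \<open>simp_all add: flat_def\<close>)
  next
    case 2
    have "((\<lambda>t. 0) has_real_derivative 0) (at t)" by simp
    then have "(flat j has_real_derivative 0) (at t)"
      by (rule has_field_derivative_transform_within_open[of _ _ _ "{..<0}"])
         (use 2 in \<open>simp_all add: flat_def\<close>)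
    then show ?thesis using 2 by (simp add: flat_def)
  next
    case 3
    then show ?thesis using flat_div_tendsto_0[of j]
      by (simp add: has_field_derivative_iff flat_def)
  qed
qed

text \<open>The induction must be over all \<open>j\<close> at once, since each differentiation
  raises the index.\<close>

lemma ck_on_flat:
  assumes "open S" "ck_on k S u"
  shows "ck_on k S (\<lambda>x. flat j (u x))"
  using assms(2)
proof (induction k arbitrary: j)
  case 0
  have "isCont (flat j) t" for t
    using has_real_derivative_flat by (rule DERIV_isCont)
  then show ?case using 0
    by (auto intro: continuous_on_compose2[of UNIV "flat j"] continuous_at_imp_continuous_on)
next
  case (Suc k)
  obtain u' where u': "\<And>x. x \<in> S \<Longrightarrow> (u has_derivative u' x) (at x)" "\<And>v. ck_on k S (\<lambda>x. u' x v)"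
    using Suc.prems by (rule ck_on_SucE) (rule that)
  show ?case
  proof (rule ck_on_SucI[OF assms(1)])
    show "((\<lambda>x. flat j (u x)) has_derivative
        (\<lambda>v. (flat (j + 2) (u x) + (- real j) * flat (j + 1) (u x)) * u' x v)) (at x)" if "x \<in> S" for x
      using has_derivative_compose[OF u'(1)[OF that]
        has_real_derivative_flat[of j "u x", unfolded has_field_derivative_def]] by simp
    show "ck_on k S (\<lambda>x. (flat (j + 2) (u x) + (- real j) * flat (j + 1) (u x)) * u' x v)" for v
      by (intro ck_on_mult ck_on_add assms(1) ck_on_const Suc.IH u'(2) ck_on_Suc_imp[OF Suc.prems])
  qed
qed

text \<open>The model space is only an inner product space with a finite spanning set, so
  compactness is built by hand: in terms of an orthogonal spanning set, a ball is a closed subset of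
  a box of bounded coefficients, and a box is a continuous image of a product of intervals.\<close>

lemma compact_cball_finite_span:
  fixes a :: "'a::real_inner"
  assumes "finite B" "span B = (UNIV :: 'a set)"
  shows "compact (cball a r)"
proof -
  obtain C where C: "finite C" "span C = (UNIV :: 'a set)" "pairwise Linear_Algebra.orthogonal C"
    using basis_orthogonal[OF assms(1)] assms(2) by metis
  define box where "box s D = {\<Sum>c\<in>D. t c *\<^sub>R c | t. \<forall>c\<in>D. \<bar>t c\<bar> \<le> s c}" for s :: "'a \<Rightarrow> real" and D
  have box: "compact (box s D)" if "finite D" for s D
    using that
  proof (induction D)
    case empty
    then show ?case by (simp add: box_def)
  next
    case (insert d D)
    have "box s (insert d D) = (\<lambda>(t, x). t *\<^sub>R d + x) ` ({- s d..s d} \<times> box s D)"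
    proof (intro equalityI subsetI)
      fix x assume "x \<in> box s (insert d D)"
      then obtain t where "x = (\<Sum>c\<in>insert d D. t c *\<^sub>R c)" "\<forall>c\<in>insert d D. \<bar>t c\<bar> \<le> s c"
        by (auto simp: box_def)
      then show "x \<in> (\<lambda>(t, x). t *\<^sub>R d + x) ` ({- s d..s d} \<times> box s D)"
        using insert.hyps
        by (intro image_eqI[of _ _ "(t d, \<Sum>c\<in>D. t c *\<^sub>R c)"]) (auto simp: box_def abs_le_iff)
    next
      fix x assume "x \<in> (\<lambda>(t, x). t *\<^sub>R d + x) ` ({- s d..s d} \<times> box s D)"
      then obtain t0 t where t: "x = t0 *\<^sub>R d + (\<Sum>c\<in>D. t c *\<^sub>R c)" "\<bar>t0\<bar> \<le> s d" "\<forall>c\<in>D. \<bar>t c\<bar> \<le> s c"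
        by (auto simp: box_def abs_le_iff)
      have "(\<Sum>c\<in>insert d D. (t(d := t0)) c *\<^sub>R c) = t0 *\<^sub>R d + (\<Sum>c\<in>D. t c *\<^sub>R c)"
        using insert.hyps by (simp, intro sum.cong) auto
      then show "x \<in> box s (insert d D)"
        using t insert.hyps unfolding box_def
        by (intro CollectI exI[of _ "t(d := t0)"]) auto
    qed
    then show ?case
      by (simp only:) (intro compact_continuous_image compact_Times insert.IH,
        auto intro!: continuous_intros simp: case_prod_beta)
  qed
  \<comment> \<open>\<open>C\<close> may contain 0, whose term vanishes because division by zero
    gives 0. The remainder \<open>y\<close> of the orthogonal expansion lies in the span of
    \<open>C\<close> and is orthogonal to \<open>C\<close>, hence to itself.\<close>
  have expand: "(\<Sum>c\<in>C. ((x \<bullet> c) / (c \<bullet> c)) *\<^sub>R c) = x" for x :: 'a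
  proof -
    define y where "y = x - (\<Sum>c\<in>C. ((x \<bullet> c) / (c \<bullet> c)) *\<^sub>R c)"
    have "y \<bullet> d = 0" if "d \<in> C" for d
    proof -
      have "(\<Sum>c\<in>C. ((x \<bullet> c) / (c \<bullet> c)) *\<^sub>R c) \<bullet> d = (\<Sum>c\<in>C. if c = d then x \<bullet> d else 0)"
        unfolding inner_sum_left
        using C(3) that by (intro sum.cong) (auto simp: pairwise_def Linear_Algebra.orthogonal_def)
      then show ?thesis using that C(1) by (simp add: y_def inner_diff_left)
    qed
    moreover have "y \<in> span C" using C by simp
    ultimately have "Linear_Algebra.orthogonal y y"
      using orthogonal_to_span by (metis Linear_Algebra.orthogonal_def)
    then show ?thesis by (simp add: y_def Linear_Algebra.orthogonal_def)
  qed
  \<comment> \<open>Cauchy-Schwarz bounds the coefficient at \<open>c\<close> by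
    \<open>r / norm c\<close>; for \<open>c = 0\<close> both sides are 0.\<close>
  have "cball 0 r \<subseteq> box (\<lambda>c. r / norm c) C"
  proof
    fix x :: 'a assume "x \<in> cball 0 r"
    have "\<bar>(x \<bullet> c) / (c \<bullet> c)\<bar> \<le> r / norm c" for c
    proof (cases "c = 0")
      case False
      have "\<bar>x \<bullet> c\<bar> \<le> norm x * norm c" by (rule Cauchy_Schwarz_ineq2)
      also have "\<dots> \<le> r * norm c" using \<open>x \<in> cball 0 r\<close> by (intro mult_right_mono) auto
      finally show ?thesis
        using False by (simp add: dot_square_norm power2_eq_square pos_divide_le_eq)
    qed simp
    then show "x \<in> box (\<lambda>c. r / norm c) C"
      unfolding box_def by (intro CollectI exI[of _ "\<lambda>c. (x \<bullet> c) / (c \<bullet> c)"]) (simp add: expand)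
  qed
  then have "compact (cball (0::'a) r)"
    using box[OF C(1)] closed_cball by (metis compact_Int_closed inf.absorb_iff2)
  then have "compact ((+) a ` cball 0 r)" by (rule compact_translation)
  then show ?thesis by (simp add: cball_translation)
qed

section \<open>Smooth functions on manifolds\<close>

locale mfd =
  fixes M :: "('m::{t2_space,second_countable_topology}, 'e::real_inner, 'z) manifold_scheme"
  assumes smooth_manifold: "smooth_manifold M"
begin

section \<open>Charts and the locality of smoothness\<close>

lemma chart_openD: "(U, \<phi>) \<in> atlas M \<Longrightarrow> open U"
  using smooth_manifold by (auto simp: smooth_manifold_def)

lemma chart_inj: "(U, \<phi>) \<in> atlas M \<Longrightarrow> inj_on \<phi> U"
  using smooth_manifold unfolding smooth_manifold_def homeomorphism_def
  by (fastforce intro: inj_on_inverseI)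

lemma chart_cover: obtains U \<phi> where "(U, \<phi>) \<in> atlas M" "p \<in> U"
proof -
  have "p \<in> (\<Union>(U, \<phi>)\<in>atlas M. U)" using smooth_manifold by (simp add: smooth_manifold_def)
  then show ?thesis using that by auto
qed

lemma chart_transition:
  "(U, \<phi>) \<in> atlas M \<Longrightarrow> (V, \<psi>) \<in> atlas M \<Longrightarrow> smooth_on (\<phi> ` (U \<inter> V)) (\<psi> \<circ> inv_into U \<phi>)"
  using smooth_manifold unfolding smooth_manifold_def by fast

lemma chart_inv_into [simp]: "(U, \<phi>) \<in> atlas M \<Longrightarrow> p \<in> U \<Longrightarrow> inv_into U \<phi> (\<phi> p) = p"
  using chart_inj inv_into_f_f by metis

lemma chart_continuous_inv:
  assumes "(U, \<phi>) \<in> atlas M"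
  shows "continuous_on (\<phi> ` U) (inv_into U \<phi>)"
proof -
  obtain \<psi> where "homeomorphism U (\<phi> ` U) \<phi> \<psi>"
    using smooth_manifold assms by (auto simp: smooth_manifold_def)
  then have "continuous_on (\<phi> ` U) \<psi>" "\<And>x. x \<in> \<phi> ` U \<Longrightarrow> inv_into U \<phi> x = \<psi> x"
    using assms by (auto simp: homeomorphism_def)
  then show ?thesis by (simp cong: continuous_on_cong)
qed

text \<open>Smoothness is tested on chart images of \<open>U \<inter> W\<close>, and the calculus
  rules need these open. Such an image is the preimage of \<open>W\<close> under the continuous
  inverse chart.\<close>

lemma chart_open_image:
  assumes "(U, \<phi>) \<in> atlas M" "open W"
  shows "open (\<phi> ` (U \<inter> W))"
proof -
  have "\<phi> ` (U \<inter> W) = inv_into U \<phi> -` W \<inter> \<phi> ` U"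
    using assms(1) by force
  moreover have "open (\<phi> ` U)"
    using smooth_manifold assms(1) by (auto simp: smooth_manifold_def)
  ultimately show ?thesis
    using chart_continuous_inv[OF assms(1)] assms(2) by (metis continuous_on_open_vimage)
qed

lemma smooth_fun_on_iff:
  "smooth_fun_on M W f \<longleftrightarrow>
    (\<forall>k. \<forall>(U, \<phi>) \<in> atlas M. ck_on k (\<phi> ` (U \<inter> W)) (\<lambda>x. f (inv_into U \<phi> x)))"
  by (auto simp: smooth_fun_on_def smooth_on_def comp_def)

lemma smooth_fun_on_cong:
  assumes "open W" "\<And>p. p \<in> W \<Longrightarrow> f p = g p" "smooth_fun_on M W f"
  shows "smooth_fun_on M W g"
  unfolding smooth_fun_on_iff
proof safe
  fix k U \<phi> assume U: "(U, \<phi>) \<in> atlas M"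
  show "ck_on k (\<phi> ` (U \<inter> W)) (\<lambda>x. g (inv_into U \<phi> x))"
  proof (rule ck_on_cong[OF chart_open_image[OF U assms(1)]])
    show "ck_on k (\<phi> ` (U \<inter> W)) (\<lambda>x. f (inv_into U \<phi> x))"
      using assms(3) U by (auto simp: smooth_fun_on_iff)
    show "f (inv_into U \<phi> x) = g (inv_into U \<phi> x)" if "x \<in> \<phi> ` (U \<inter> W)" for x
      using that U by (auto simp: assms(2))
  qed
qed

lemma smooth_fun_on_mono: "W' \<subseteq> W \<Longrightarrow> smooth_fun_on M W f \<Longrightarrow> smooth_fun_on M W' f"
  unfolding smooth_fun_on_def smooth_on_def
  by (blast intro: ck_on_mono[OF image_mono[OF Int_mono[OF order_refl]]])

lemma smooth_fun_on_local:
  assumes "\<And>p. p \<in> W \<Longrightarrow> \<exists>V. open V \<and> p \<in> V \<and> smooth_fun_on M V f"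
  shows "smooth_fun_on M W f"
  unfolding smooth_fun_on_iff
proof safe
  fix k U \<phi> assume U: "(U, \<phi>) \<in> atlas M"
  show "ck_on k (\<phi> ` (U \<inter> W)) (\<lambda>x. f (inv_into U \<phi> x))"
  proof (rule ck_on_local)
    fix x assume "x \<in> \<phi> ` (U \<inter> W)"
    then obtain p where p: "x = \<phi> p" "p \<in> U" "p \<in> W" by auto
    then obtain V where "open V" "p \<in> V" "smooth_fun_on M V f" using assms by blast
    with p U show "\<exists>T. open T \<and> x \<in> T \<and> ck_on k T (\<lambda>x. f (inv_into U \<phi> x))"
      by (intro exI[of _ "\<phi> ` (U \<inter> V)"]) (auto simp: smooth_fun_on_iff chart_open_image)
  qed
qed

lemma smooth_fun_on_const: "open W \<Longrightarrow> smooth_fun_on M W (\<lambda>p. c)"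
  unfolding smooth_fun_on_iff by (auto intro: ck_on_const chart_open_image)

lemma smooth_fun_on_add:
  "open W \<Longrightarrow> smooth_fun_on M W f \<Longrightarrow> smooth_fun_on M W g \<Longrightarrow> smooth_fun_on M W (\<lambda>p. f p + g p)"
  unfolding smooth_fun_on_iff by (auto intro!: ck_on_add chart_open_image)

lemma smooth_fun_on_mult:
  "open W \<Longrightarrow> smooth_fun_on M W f \<Longrightarrow> smooth_fun_on M W g \<Longrightarrow> smooth_fun_on M W (\<lambda>p. f p * g p)"
  unfolding smooth_fun_on_iff by (auto intro!: ck_on_mult chart_open_image)

lemma smooth_fun_on_inverse:
  assumes "open W" "smooth_fun_on M W f" "\<And>p. p \<in> W \<Longrightarrow> f p \<noteq> 0"
  shows "smooth_fun_on M W (\<lambda>p. inverse (f p))"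
  using assms unfolding smooth_fun_on_iff by (auto intro!: ck_on_inverse chart_open_image)

lemma smooth_fun_on_sum:
  assumes "open W" "\<And>i. i \<in> I \<Longrightarrow> smooth_fun_on M W (f i)"
  shows "smooth_fun_on M W (\<lambda>p. \<Sum>i\<in>I. f i p)"
  using assms(2)
  by (induction I rule: infinite_finite_induct)
     (auto intro: smooth_fun_on_const smooth_fun_on_add assms(1))

lemma smooth_fun_on_prod:
  assumes "open W" "\<And>i. i \<in> I \<Longrightarrow> smooth_fun_on M W (f i)"
  shows "smooth_fun_on M W (\<lambda>p. \<Prod>i\<in>I. f i p)"
  using assms(2)
  by (induction I rule: infinite_finite_induct)
     (auto intro: smooth_fun_on_const smooth_fun_on_mult assms(1))

text \<open>In a chart around \<open>p\<close> take exp(-1/(r^2 - |x - x0|^2)) on a small ball,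
  normalise it to 1 at the centre and extend it by zero. The closed set \<open>K\<close> is kept in
  the conclusion so that local objects multiplied by \<open>h\<close> can be extended by zero as
  well.\<close>

lemma bump_function:
  assumes "open W" "p \<in> W"
  obtains h K where "smooth_fun_on M UNIV h" "h p = 1" "closed K" "K \<subseteq> W" "\<And>q. q \<notin> K \<Longrightarrow> h q = 0"
proof -
  obtain U \<phi> where U: "(U, \<phi>) \<in> atlas M" "p \<in> U" by (rule chart_cover)
  then have "open (\<phi> ` (U \<inter> W))" "\<phi> p \<in> \<phi> ` (U \<inter> W)"
    using chart_open_image assms by auto
  then obtain r where r: "r > 0" "cball (\<phi> p) r \<subseteq> \<phi> ` (U \<inter> W)"
    using open_contains_cball by blast
  define K where "K = inv_into U \<phi> ` cball (\<phi> p) r"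
  define u where "u q = r\<^sup>2 + (- 1) * ((\<phi> q - \<phi> p) \<bullet> (\<phi> q - \<phi> p))" for q
  define h where "h q = (if q \<in> U then inverse (flat 0 (r\<^sup>2)) * flat 0 (u q) else 0)" for q
  obtain B :: "'e set" where "finite B" "span B = UNIV"
    using smooth_manifold by (auto simp: smooth_manifold_def)
  moreover have "continuous_on (cball (\<phi> p) r) (inv_into U \<phi>)"
    by (rule continuous_on_subset[OF chart_continuous_inv[OF U(1)]]) (use r(2) in blast)
  \<comment> \<open>In a Hausdorff manifold the compact set \<open>K\<close> is closed. Hence
    \<open>U\<close> and the complement of \<open>K\<close> form an open cover on which
    \<open>h\<close> is given by the explicit formula and by 0 respectively.\<close>
  ultimately have "compact K"
    unfolding K_def by (intro compact_continuous_image compact_cball_finite_span)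
  then have "closed K" by (rule compact_imp_closed)
  have "K \<subseteq> U \<inter> W" using r(2) U(1) by (auto simp: K_def)
  have zero: "h q = 0" if "q \<notin> K" for q
  proof (cases "q \<in> U")
    case True
    then have "\<phi> q \<notin> cball (\<phi> p) r"
      using that U(1) by (metis K_def chart_inv_into image_eqI)
    then have "r < norm (\<phi> q - \<phi> p)" by (simp add: dist_norm norm_minus_commute)
    then have "u q \<le> 0" using r(1) by (simp add: u_def dot_square_norm power_mono)
    then show ?thesis by (simp add: h_def flat_def)
  qed (simp add: h_def)
  have "smooth_fun_on M UNIV h"
  proof (rule smooth_fun_on_local)
    fix q :: 'm
    show "\<exists>V. open V \<and> q \<in> V \<and> smooth_fun_on M V h"
    proof (cases "q \<in> K")
      case False
      then show ?thesis
        using \<open>closed K\<close> zero smooth_fun_on_cong[of "- K" "\<lambda>_. 0" h] smooth_fun_on_const[of "- K" 0]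
        by (intro exI[of _ "- K"]) auto
    next
      case True
      have "smooth_fun_on M U (\<lambda>q. inverse (flat 0 (r\<^sup>2)) * flat 0 (u q))"
        unfolding smooth_fun_on_iff
      proof safe
        fix k V \<psi> assume V: "(V, \<psi>) \<in> atlas M"
        have o: "open (\<psi> ` (V \<inter> U))" using V U by (intro chart_open_image chart_openD)
        \<comment> \<open>Seen from another chart, the bump is a composite with the transition map,
          which the atlas makes smooth.\<close>
        have "ck_on k (\<psi> ` (V \<inter> U)) (\<lambda>x. \<phi> (inv_into V \<psi> x))"
          using chart_transition[OF V U(1)] by (simp add: smooth_on_def comp_def)
        then have *: "ck_on k (\<psi> ` (V \<inter> U)) (\<lambda>x. \<phi> (inv_into V \<psi> x) + (- \<phi> p))"
          by (intro ck_on_add o ck_on_const)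
        have "ck_on k (\<psi> ` (V \<inter> U)) (\<lambda>x. inverse (flat 0 (r\<^sup>2)) * flat 0 (r\<^sup>2 + (- 1) *
            ((\<phi> (inv_into V \<psi> x) + (- \<phi> p)) \<bullet> (\<phi> (inv_into V \<psi> x) + (- \<phi> p)))))"
          by (intro ck_on_mult ck_on_flat ck_on_add bounded_bilinear.ck_on[OF bounded_bilinear_inner] o ck_on_const *)
        then show "ck_on k (\<psi> ` (V \<inter> U)) (\<lambda>x. inverse (flat 0 (r\<^sup>2)) * flat 0 (u (inv_into V \<psi> x)))"
          by (simp add: u_def)
      qed
      then have "smooth_fun_on M U h"
        by (rule smooth_fun_on_cong[rotated 2]) (use chart_openD[OF U(1)] in \<open>auto simp: h_def\<close>)
      then show ?thesis using True \<open>K \<subseteq> U \<inter> W\<close> chart_openD[OF U(1)] by auto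
    qed
  qed
  moreover have "h p = 1" using U(2) r(1) by (simp add: h_def u_def flat_def)
  ultimately show ?thesis using that \<open>closed K\<close> \<open>K \<subseteq> U \<inter> W\<close> zero by blast
qed

section \<open>Smooth dependence of solutions of linear systems\<close>

lemma smooth_fun_on_det:
  assumes W: "open W" and G: "\<And>i j. i < n \<Longrightarrow> j < n \<Longrightarrow> smooth_fun_on M W (G i j)"
  shows "smooth_fun_on M W (\<lambda>p. Determinant.det (Matrix.mat n n (\<lambda>(i, j). G i j p)))"
proof -
  have "smooth_fun_on M W (\<lambda>p. \<Sum>\<pi>\<in>{\<pi>. \<pi> permutes {0..<n}}. signof \<pi> * (\<Prod>i=0..<n. G i (\<pi> i) p))"
    by (intro smooth_fun_on_sum smooth_fun_on_mult smooth_fun_on_prod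
      smooth_fun_on_const W G) (use permutes_in_image in fastforce)+
  moreover have "(\<Sum>\<pi>\<in>{\<pi>. \<pi> permutes {0..<n}}. signof \<pi> * (\<Prod>i=0..<n. G i (\<pi> i) p))
      = Determinant.det (Matrix.mat n n (\<lambda>(i, j). G i j p))" for p
    by (subst det_def'[of _ n]) (use permutes_in_image in \<open>fastforce intro!: sum.cong prod.cong arg_cong2[of _ _ _ _ "(*)"]\<close>)+
  ultimately show ?thesis by simp
qed

lemma smooth_fun_on_cofactor:
  assumes W: "open W" and G: "\<And>i j. i < n \<Longrightarrow> j < n \<Longrightarrow> smooth_fun_on M W (G i j)"
  shows "smooth_fun_on M W (\<lambda>p. cofactor (Matrix.mat n n (\<lambda>(i, j). G i j p)) k l)"
proof -
  \<comment> \<open>\<open>s k\<close> enumerates in increasing order the indices other than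
    \<open>k\<close>, as \<open>mat_delete\<close> does.\<close>
  define s where "s k i = (if i < k then i else Suc i)" for k i :: nat
  have "smooth_fun_on M W (\<lambda>p. (- 1) ^ (k + l) *
      Determinant.det (Matrix.mat (n - 1) (n - 1) (\<lambda>(i, j). G (s k i) (s l j) p)))"
    by (intro smooth_fun_on_mult smooth_fun_on_const smooth_fun_on_det W G) (auto simp: s_def)
  moreover have "Matrix.mat (n - 1) (n - 1) (\<lambda>(i, j). G (s k i) (s l j) p)
      = mat_delete (Matrix.mat n n (\<lambda>(i, j). G i j p)) k l" for p
    by (rule eq_matI) (auto simp: mat_delete_def s_def)
  ultimately show ?thesis by (simp add: cofactor_def)
qed

text \<open>Cramer's rule: the solution is the adjugate applied to \<open>b\<close>, divided by the
  determinant, hence smooth wherever the determinant does not vanish. The assumption of trivial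
  kernel gives exactly this.\<close>

lemma smooth_linear_system:
  fixes n :: nat
  assumes W: "open W"
    and G: "\<And>i j. i < n \<Longrightarrow> j < n \<Longrightarrow> smooth_fun_on M W (G i j)"
    and b: "\<And>i. i < n \<Longrightarrow> smooth_fun_on M W (b i)"
    and nondeg: "\<And>p v i. p \<in> W \<Longrightarrow> (\<And>k. k < n \<Longrightarrow> (\<Sum>i<n. G k i p * v i) = 0) \<Longrightarrow> i < n \<Longrightarrow> v i = 0"
  obtains c where "\<And>i. i < n \<Longrightarrow> smooth_fun_on M W (c i)"
    "\<And>p k. p \<in> W \<Longrightarrow> k < n \<Longrightarrow> (\<Sum>i<n. G k i p * c i p) = b k p"
proof -
  define D where "D p = Matrix.mat n n (\<lambda>(i, j). G i j p)" for p
  define c where "c i p = inverse (Determinant.det (D p)) * (\<Sum>l<n. cofactor (D p) l i * b l p)" for i p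
  have D [simp]: "D p \<in> carrier_mat n n" for p by (simp add: D_def)
  have det: "Determinant.det (D p) \<noteq> 0" if p: "p \<in> W" for p
  proof
    assume "Determinant.det (D p) = 0"
    then obtain v where v: "v \<in> carrier_vec n" "v \<noteq> 0\<^sub>v n" "D p *\<^sub>v v = 0\<^sub>v n"
      using det_0_iff_vec_prod_zero_field[OF D] by blast
    have "(\<Sum>i<n. G k i p * vec_index v i) = 0" if "k < n" for k
    proof -
      have "vec_index (D p *\<^sub>v v) k = 0" using v that by simp
      then show ?thesis
        using that v(1) by (auto simp: D_def scalar_prod_def lessThan_atLeast0)
    qed
    then have "vec_index v i = 0" if "i < n" for i using nondeg[OF p] that by blast
    then have "v = 0\<^sub>v n" using v(1) by (intro eq_vecI) auto
    with v(2) show False by contradiction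
  qed
  have "smooth_fun_on M W (c i)" if "i < n" for i
    unfolding c_def using det unfolding D_def
    by (intro smooth_fun_on_mult smooth_fun_on_inverse smooth_fun_on_det smooth_fun_on_sum
        smooth_fun_on_cofactor W G b) auto
  moreover have "(\<Sum>i<n. G k i p * c i p) = b k p" if p: "p \<in> W" and k: "k < n" for p k
  proof -
    have *: "(\<Sum>i<n. G k i p * cofactor (D p) l i) = (if k = l then Determinant.det (D p) else 0)" if "l < n" for l
    proof -
      have "(D p * adj_mat (D p)) $$ (k, l) = (\<Sum>i<n. G k i p * cofactor (D p) l i)"
        using k that by (auto simp: D_def adj_mat_def scalar_prod_def lessThan_atLeast0 intro!: sum.cong)
      then show ?thesis using k that adj_mat(2)[OF D] by (cases "k = l") simp_all
    qed
    have "(\<Sum>i<n. G k i p * c i p)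
        = (\<Sum>i<n. \<Sum>l<n. inverse (Determinant.det (D p)) * b l p * (G k i p * cofactor (D p) l i))"
      unfolding c_def by (simp add: sum_distrib_left mult_ac)
    also have "\<dots> = (\<Sum>l<n. inverse (Determinant.det (D p)) * b l p * (\<Sum>i<n. G k i p * cofactor (D p) l i))"
      by (subst sum.swap) (simp add: sum_distrib_left)
    also have "\<dots> = (\<Sum>l<n. if k = l then b l p else 0)"
      using * det[OF p] by (intro sum.cong) auto
    finally show ?thesis using k by simp
  qed
  ultimately show ?thesis by (rule that)
qed

end

section \<open>Sections and tensors of a vector bundle\<close>

locale smooth_vbundle =
  fixes A :: "('m::{t2_space,second_countable_topology}, 'e::real_inner, 'v::real_vector, 'z) vbundle_scheme"
  assumes vector_bundle: "vector_bundle A"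

sublocale smooth_vbundle \<subseteq> mfd A
  using vector_bundle by unfold_locales (simp add: vector_bundle_def)

context smooth_vbundle begin

abbreviation "rk \<equiv> bundle_rank A"

section \<open>Local frames and coordinates\<close>

lemma frame_open: "(U, e) \<in> frames A \<Longrightarrow> open U"
  using vector_bundle by (auto simp: vector_bundle_def)

lemma frame_cover: obtains U e where "(U, e) \<in> frames A" "p \<in> U"
proof -
  have "p \<in> (\<Union>(U, e)\<in>frames A. U)" using vector_bundle by (simp add: vector_bundle_def)
  then show ?thesis using that by auto
qed

lemma frame_span:
  "(U, e) \<in> frames A \<Longrightarrow> p \<in> U \<Longrightarrow> fibre A p = span ((\<lambda>i. e i p) ` {..<rk})"
  using vector_bundle unfolding vector_bundle_def by fast

lemma frame_transition:
  "(U, e) \<in> frames A \<Longrightarrow> (V, e') \<in> frames A \<Longrightarrow> j < rk \<Longrightarrow> smooth_in_frame A (U \<inter> V) e (e' j)"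
  using vector_bundle unfolding vector_bundle_def by fast

lemma subspace_fibre: "subspace (fibre A p)"
  by (metis frame_cover frame_span subspace_span)

lemmas fibre_add [simp] = subspace_add[OF subspace_fibre]
  and fibre_diff [simp] = subspace_diff[OF subspace_fibre]
  and fibre_scale [simp] = subspace_scale[OF subspace_fibre]
  and fibre_zero [simp] = subspace_0[OF subspace_fibre]
  and fibre_sum = subspace_sum[OF subspace_fibre]

lemma frame_in_fibre: "(U, e) \<in> frames A \<Longrightarrow> p \<in> U \<Longrightarrow> i < rk \<Longrightarrow> e i p \<in> fibre A p"
  using frame_span by (auto intro: span_base)

lemma frame_expand:
  assumes "(U, e) \<in> frames A" "p \<in> U" "v \<in> fibre A p"
  obtains a where "v = (\<Sum>i<rk. a i *\<^sub>R e i p)"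
proof -
  have inj: "inj_on (\<lambda>i. e i p) {..<rk}"
    using vector_bundle assms(1,2) unfolding vector_bundle_def by fast
  have "v \<in> span ((\<lambda>i. e i p) ` {..<rk})" using frame_span assms by blast
  then obtain a where "v = (\<Sum>w\<in>(\<lambda>i. e i p) ` {..<rk}. a w *\<^sub>R w)"
    by (auto simp: span_finite)
  then show ?thesis using that[of "\<lambda>i. a (e i p)"] by (simp add: sum.reindex[OF inj])
qed

lemma frame_unique:
  assumes "(U, e) \<in> frames A" "p \<in> U" "(\<Sum>i<rk. a i *\<^sub>R e i p) = (\<Sum>i<rk. b i *\<^sub>R e i p)" "j < rk"
  shows "a j = b j"
proof -
  have inj: "inj_on (\<lambda>i. e i p) {..<rk}" and ind: "independent ((\<lambda>i. e i p) ` {..<rk})"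
    using vector_bundle assms(1,2) unfolding vector_bundle_def by fast+
  define f where "f = (\<lambda>i. e i p)"
  \<comment> \<open>Independence speaks about a set of vectors, so the indexed coefficients are
    transported along the injective indexing: \<open>u\<close> recovers the index from the
    vector.\<close>
  define u where "u w = (let i = inv_into {..<rk} f w in a i - b i)" for w
  have u: "u (f i) = a i - b i" if "i < rk" for i
    using inv_into_f_f[of f "{..<rk}" i] inj that by (simp add: u_def flip: f_def)
  have "(\<Sum>w\<in>f ` {..<rk}. u w *\<^sub>R w) = (\<Sum>i<rk. u (f i) *\<^sub>R f i)"
    using inj by (simp add: f_def sum.reindex)
  also have "\<dots> = (\<Sum>i<rk. (a i - b i) *\<^sub>R f i)" using u by simp
  also have "\<dots> = 0" using assms(3) by (simp add: f_def scaleR_diff_left sum_subtractf)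
  finally have "u (f j) = 0"
    using ind assms(4) independentD[of "f ` {..<rk}" "f ` {..<rk}" u "f j"] by (simp add: f_def)
  then show ?thesis using u assms(4) by simp
qed

lemma smooth_in_frameE:
  assumes "smooth_in_frame A U e X"
  obtains c where "\<And>i. i < rk \<Longrightarrow> smooth_fun_on A U (c i)"
    "\<And>p. p \<in> U \<Longrightarrow> X p = (\<Sum>i<rk. c i p *\<^sub>R e i p)"
proof -
  obtain c where "\<forall>i<rk. smooth_fun_on A U (c i)" "\<forall>p\<in>U. X p = (\<Sum>i<rk. c i p *\<^sub>R e i p)"
    using assms unfolding smooth_in_frame_def by (elim exE conjE)
  then show ?thesis by (intro that[of c]) simp_all
qed

lemma smooth_in_frame_frame:
  assumes "open U" "j < rk"
  shows "smooth_in_frame A U e (e j)"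
  unfolding smooth_in_frame_def
  using assms by (intro exI[of _ "\<lambda>i p. if i = j then 1 else 0"])
    (auto intro: smooth_fun_on_const simp: if_distrib[of "\<lambda>a. a *\<^sub>R _"] cong: if_cong)

lemma smooth_in_frame_mono: "V \<subseteq> U \<Longrightarrow> smooth_in_frame A U e X \<Longrightarrow> smooth_in_frame A V e X"
  unfolding smooth_in_frame_def using smooth_fun_on_mono by blast

text \<open>The common source of smoothness below. Empty, one-element and two-element index sets
  give the zero section, scaling and addition; indexing by a second frame gives a change of
  frame.\<close>

lemma smooth_in_frame_combination:
  assumes "open U" "\<And>i. i \<in> I \<Longrightarrow> smooth_fun_on A U (c i)"
    "\<And>i. i \<in> I \<Longrightarrow> smooth_in_frame A U e (Y i)" "\<And>p. p \<in> U \<Longrightarrow> X p = (\<Sum>i\<in>I. c i p *\<^sub>R Y i p)"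
  shows "smooth_in_frame A U e X"
proof -
  obtain d where d: "\<And>i j. i \<in> I \<Longrightarrow> j < rk \<Longrightarrow> smooth_fun_on A U (d i j)"
      "\<And>i p. i \<in> I \<Longrightarrow> p \<in> U \<Longrightarrow> Y i p = (\<Sum>j<rk. d i j p *\<^sub>R e j p)"
    using assms(3) unfolding smooth_in_frame_def by metis
  have "X p = (\<Sum>j<rk. (\<Sum>i\<in>I. c i p * d i j p) *\<^sub>R e j p)" if "p \<in> U" for p
  proof -
    have "X p = (\<Sum>i\<in>I. \<Sum>j<rk. (c i p * d i j p) *\<^sub>R e j p)"
      using that by (simp add: assms(4) d(2) scaleR_sum_right)
    then show ?thesis by (subst (asm) sum.swap) (simp add: scaleR_sum_left)
  qed
  moreover have "smooth_fun_on A U (\<lambda>p. \<Sum>i\<in>I. c i p * d i j p)" if "j < rk" for j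
    using that by (intro smooth_fun_on_sum smooth_fun_on_mult assms d)
  ultimately show ?thesis unfolding smooth_in_frame_def by (intro exI[of _ "\<lambda>j p. \<Sum>i\<in>I. c i p * d i j p"]) simp
qed

lemma smooth_in_frame_add:
  assumes "open U" "smooth_in_frame A U e X" "smooth_in_frame A U e Y"
  shows "smooth_in_frame A U e (\<lambda>p. X p + Y p)"
  by (rule smooth_in_frame_combination[of U UNIV "\<lambda>_ _. 1" e "\<lambda>b. if b then X else Y"])
     (use assms in \<open>simp_all add: UNIV_bool smooth_fun_on_const\<close>)

lemma smooth_in_frame_scale:
  assumes "open U" "smooth_in_frame A U e X"
  shows "smooth_in_frame A U e (\<lambda>p. c *\<^sub>R X p)"
  by (rule smooth_in_frame_combination[of U "{()}" "\<lambda>_ _. c" e "\<lambda>_. X"])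
     (use assms in \<open>simp_all add: smooth_fun_on_const\<close>)

text \<open>Coordinates in a frame are unique, so locally found smooth coefficients agree with one
  global choice of coordinates, which is therefore smooth.\<close>

lemma smooth_in_frame_local:
  assumes "(U, e) \<in> frames A"
    "\<And>p. p \<in> U \<Longrightarrow> \<exists>V. open V \<and> p \<in> V \<and> smooth_in_frame A (U \<inter> V) e X"
  shows "smooth_in_frame A U e X"
proof -
  define a where "a p = (SOME a. X p = (\<Sum>i<rk. a i *\<^sub>R e i p))" for p
  have a: "X p = (\<Sum>i<rk. a p i *\<^sub>R e i p)" if "\<exists>a. X p = (\<Sum>i<rk. a i *\<^sub>R e i p)" for p
    unfolding a_def using that by (rule someI_ex)
  have coords: "a p i = c i" if "p \<in> U" "X p = (\<Sum>i<rk. c i *\<^sub>R e i p)" "i < rk" for p c i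
  proof (rule frame_unique[OF assms(1) that(1) _ that(3)])
    show "(\<Sum>i<rk. a p i *\<^sub>R e i p) = (\<Sum>i<rk. c i *\<^sub>R e i p)"
      using a[OF exI, OF that(2)] that(2) by simp
  qed
  have "smooth_fun_on A U (\<lambda>p. a p i)" if "i < rk" for i
  proof (rule smooth_fun_on_local)
    fix p assume "p \<in> U"
    then obtain V where V: "open V" "p \<in> V" "smooth_in_frame A (U \<inter> V) e X"
      using assms(2)[of p] by blast
    obtain c where c: "\<And>i. i < rk \<Longrightarrow> smooth_fun_on A (U \<inter> V) (c i)"
        "\<And>q. q \<in> U \<inter> V \<Longrightarrow> X q = (\<Sum>i<rk. c i q *\<^sub>R e i q)"
      using V(3) by (rule smooth_in_frameE) (rule that)
    have "smooth_fun_on A (U \<inter> V) (\<lambda>p. a p i)"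
    proof (rule smooth_fun_on_cong[OF _ _ c(1)[OF \<open>i < rk\<close>]])
      show "open (U \<inter> V)" using V(1) frame_open[OF assms(1)] by blast
      show "c i q = a q i" if "q \<in> U \<inter> V" for q
        using coords[OF _ c(2)[OF that] \<open>i < rk\<close>] that by simp
    qed
    then show "\<exists>V. open V \<and> p \<in> V \<and> smooth_fun_on A V (\<lambda>p. a p i)"
      using V \<open>p \<in> U\<close> frame_open[OF assms(1)] by blast
  qed
  moreover have "X p = (\<Sum>i<rk. a p i *\<^sub>R e i p)" if "p \<in> U" for p
    using assms(2)[OF that] that by (intro a) (force simp: smooth_in_frame_def)
  ultimately show ?thesis unfolding smooth_in_frame_def by (intro exI[of _ "\<lambda>i p. a p i"]) simp
qed

section \<open>Global sections\<close>

lemma Sec_fibre [simp]: "X \<in> Sec A \<Longrightarrow> X p \<in> fibre A p"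
  by (simp add: Sec_def)

lemma Sec_smooth: "X \<in> Sec A \<Longrightarrow> (U, e) \<in> frames A \<Longrightarrow> smooth_in_frame A U e X"
  unfolding Sec_def by fast

lemma SecI:
  "(\<And>p. X p \<in> fibre A p) \<Longrightarrow> (\<And>U e. (U, e) \<in> frames A \<Longrightarrow> smooth_in_frame A U e X) \<Longrightarrow> X \<in> Sec A"
  unfolding Sec_def by fast

text \<open>Near each point a single frame of one's choice suffices: the smooth transition matrices
  carry the coefficients to every other frame.\<close>

lemma SecI_local:
  assumes "\<And>p. X p \<in> fibre A p"
    "\<And>p. \<exists>V U e. open V \<and> p \<in> V \<and> V \<subseteq> U \<and> (U, e) \<in> frames A \<and> smooth_in_frame A V e X"
  shows "X \<in> Sec A"
proof -
  have "smooth_in_frame A U e X" if U: "(U, e) \<in> frames A" for U e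
  proof (rule smooth_in_frame_local[OF U])
    fix p assume "p \<in> U"
    obtain V U' e' where V: "open V" "p \<in> V" "V \<subseteq> U'" "(U', e') \<in> frames A" "smooth_in_frame A V e' X"
      using assms(2)[of p] by (elim exE conjE)
    obtain c where c: "\<And>i. i < rk \<Longrightarrow> smooth_fun_on A V (c i)"
        "\<And>q. q \<in> V \<Longrightarrow> X q = (\<Sum>i<rk. c i q *\<^sub>R e' i q)"
      using V(5) by (rule smooth_in_frameE) (rule that)
    have "smooth_in_frame A (U \<inter> V) e X"
    proof (rule smooth_in_frame_combination)
      show "open (U \<inter> V)" using V(1) frame_open[OF U] by blast
      show "smooth_fun_on A (U \<inter> V) (c i)" if "i \<in> {..<rk}" for i
        using c(1) that smooth_fun_on_mono[of "U \<inter> V" V] by auto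
      show "smooth_in_frame A (U \<inter> V) e (e' i)" if "i \<in> {..<rk}" for i
        by (rule smooth_in_frame_mono[OF _ frame_transition[OF U V(4)]]) (use that V(3) in auto)
    qed (use c in auto)
    then show "\<exists>V. open V \<and> p \<in> V \<and> smooth_in_frame A (U \<inter> V) e X" using V by blast
  qed
  then show ?thesis by (intro SecI assms(1))
qed

text \<open>Extend \<open>v\<close> with constant coefficients in a local frame and multiply by a
  bump function. This lets identities between fibre vectors be tested on global sections
  only.\<close>

lemma section_through:
  assumes "v \<in> fibre A p"
  obtains X where "X \<in> Sec A" "X p = v"
proof -
  obtain U e where U: "(U, e) \<in> frames A" "p \<in> U" by (rule frame_cover)
  obtain a where a: "v = (\<Sum>i<rk. a i *\<^sub>R e i p)" using frame_expand U assms by blast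
  obtain h K where h: "smooth_fun_on A UNIV h" "h p = 1" "closed K" "K \<subseteq> U" "\<And>q. q \<notin> K \<Longrightarrow> h q = 0"
    using bump_function frame_open U by metis
  define X where "X q = (if q \<in> U then \<Sum>i<rk. (h q * a i) *\<^sub>R e i q else 0)" for q
  have "X \<in> Sec A"
  proof (rule SecI_local)
    show "X q \<in> fibre A q" for q
      using frame_in_fibre[OF U(1)] by (auto simp: X_def intro: fibre_sum)
    show "\<exists>V U e. open V \<and> q \<in> V \<and> V \<subseteq> U \<and> (U, e) \<in> frames A \<and> smooth_in_frame A V e X" for q
    proof (cases "q \<in> U")
      case True
      have "smooth_in_frame A U e X"
        by (rule smooth_in_frame_combination[of U "{..<rk}" "\<lambda>i q. h q * a i" e e])
           (use frame_open[OF U(1)] smooth_fun_on_mono[OF _ h(1), of U] in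
             \<open>auto simp: X_def intro!: smooth_fun_on_mult smooth_fun_on_const smooth_in_frame_frame\<close>)
      then show ?thesis using True U frame_open by blast
    next
      case False
      obtain U' e' where U': "(U', e') \<in> frames A" "q \<in> U'" by (rule frame_cover)
      \<comment> \<open>A point outside \<open>U\<close> lies outside \<open>K\<close>, so it has
        this neighbourhood, on which \<open>X\<close> is zero, an empty combination of frame
        sections.\<close>
      have o: "open (U' - K)" using h(3) frame_open[OF U'(1)] by blast
      have "X r = 0" if "r \<notin> K" for r using h(5)[OF that] by (simp add: X_def)
      then have "smooth_in_frame A (U' - K) e' X"
        using smooth_in_frame_combination[of "U' - K" "{}" "\<lambda>_ _. 0" e' "\<lambda>_. X" X] o by simp
      then show ?thesis using False h(4) U' o by (intro exI[of _ "U' - K"] exI[of _ U'] exI[of _ e']) blast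
    qed
  qed
  moreover have "X p = v" using U a h(2) by (simp add: X_def)
  ultimately show ?thesis by (rule that)
qed

lemma Sec_add: "X \<in> Sec A \<Longrightarrow> Y \<in> Sec A \<Longrightarrow> (\<lambda>p. X p + Y p) \<in> Sec A"
  by (rule SecI) (auto intro!: smooth_in_frame_add intro: Sec_smooth frame_open)

lemma Sec_scale: "X \<in> Sec A \<Longrightarrow> (\<lambda>p. c *\<^sub>R X p) \<in> Sec A"
  by (rule SecI) (auto intro!: smooth_in_frame_scale intro: Sec_smooth frame_open)

section \<open>Algebra of (1,1)-tensors\<close>

lemma tensor_fibre [simp]: "tensor11 A T \<Longrightarrow> v \<in> fibre A p \<Longrightarrow> T p v \<in> fibre A p"
  by (auto simp: tensor11_def)

lemma tensor_add: "tensor11 A T \<Longrightarrow> u \<in> fibre A p \<Longrightarrow> v \<in> fibre A p \<Longrightarrow> T p (u + v) = T p u + T p v"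
  by (auto simp: tensor11_def)

lemma tensor_scale: "tensor11 A T \<Longrightarrow> u \<in> fibre A p \<Longrightarrow> T p (c *\<^sub>R u) = c *\<^sub>R T p u"
  by (auto simp: tensor11_def)

lemma tensor_frame:
  "tensor11 A T \<Longrightarrow> (U, e) \<in> frames A \<Longrightarrow> j < rk \<Longrightarrow> smooth_in_frame A U e (\<lambda>p. T p (e j p))"
  unfolding tensor11_def by fast

lemma tensor_diff:
  assumes "tensor11 A T" "u \<in> fibre A p" "v \<in> fibre A p" shows "T p (u - v) = T p u - T p v"
  using tensor_add[OF assms(1,2), of "(- 1) *\<^sub>R v"] tensor_scale[OF assms(1,3), where c = "- 1"] assms
    fibre_scale[of v p "- 1"]
  by simp

lemma tensor_sum:
  assumes "tensor11 A T" "\<And>i. i \<in> I \<Longrightarrow> v i \<in> fibre A p"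
  shows "T p (\<Sum>i\<in>I. c i *\<^sub>R v i) = (\<Sum>i\<in>I. c i *\<^sub>R T p (v i))"
  using assms(2)
proof (induction I rule: infinite_finite_induct)
  case (insert i I)
  then show ?case
    by (simp add: tensor_add[OF assms(1)] tensor_scale[OF assms(1)] fibre_sum)
qed (use tensor_scale[OF assms(1) fibre_zero, where c = 0] in simp_all)

lemma smooth_in_frame_tensor:
  assumes "tensor11 A T" "(U, e) \<in> frames A" "smooth_in_frame A U e X"
  shows "smooth_in_frame A U e (\<lambda>p. T p (X p))"
proof -
  obtain c where c: "\<And>i. i < rk \<Longrightarrow> smooth_fun_on A U (c i)"
      "\<And>p. p \<in> U \<Longrightarrow> X p = (\<Sum>i<rk. c i p *\<^sub>R e i p)"
    using assms(3) by (rule smooth_in_frameE) (rule that)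
  show ?thesis
  proof (rule smooth_in_frame_combination[of U "{..<rk}" c e "\<lambda>i p. T p (e i p)"])
    show "T p (X p) = (\<Sum>i<rk. c i p *\<^sub>R T p (e i p))" if "p \<in> U" for p
      unfolding c(2)[OF that]
      by (rule tensor_sum[OF assms(1)]) (use that frame_in_fibre[OF assms(2)] in blast)
  qed (use assms c frame_open tensor_frame[OF assms(1,2)] in simp_all)
qed

lemma tens_app_Sec:
  assumes "tensor11 A T" "X \<in> Sec A" shows "tens_app T X \<in> Sec A"
  unfolding tens_app_def
  by (rule SecI) (use assms in \<open>simp_all add: smooth_in_frame_tensor[OF assms(1)] Sec_smooth\<close>)

lemma tensor_eqI:
  assumes "tensor11 A S" "tensor11 A T" "\<And>p v. v \<in> fibre A p \<Longrightarrow> S p v = T p v"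
  shows "S = T"
proof (intro ext)
  fix p v show "S p v = T p v"
    using assms by (cases "v \<in> fibre A p") (auto simp: tensor11_def PiE_def extensional_def)
qed

lemma tensor11I:
  assumes "\<And>p v. v \<in> fibre A p \<Longrightarrow> T p v \<in> fibre A p"
    "\<And>p v. v \<notin> fibre A p \<Longrightarrow> T p v = undefined"
    "\<And>p u v. u \<in> fibre A p \<Longrightarrow> v \<in> fibre A p \<Longrightarrow> T p (u + v) = T p u + T p v"
    "\<And>p u c. u \<in> fibre A p \<Longrightarrow> T p (c *\<^sub>R u) = c *\<^sub>R T p u"
    "\<And>U e j. (U, e) \<in> frames A \<Longrightarrow> j < rk \<Longrightarrow> smooth_in_frame A U e (\<lambda>p. T p (e j p))"
  shows "tensor11 A T"
  unfolding tensor11_def using assms by auto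

lemma smooth_in_frame_cong:
  "(\<And>p. p \<in> U \<Longrightarrow> X p = Y p) \<Longrightarrow> smooth_in_frame A U e X \<Longrightarrow> smooth_in_frame A U e Y"
  by (auto simp: smooth_in_frame_def)

lemma tens_id_apply [simp]: "v \<in> fibre A p \<Longrightarrow> tens_id A p v = v"
  and tens_zero_apply [simp]: "v \<in> fibre A p \<Longrightarrow> tens_zero A p v = 0"
  and tens_add_apply [simp]: "v \<in> fibre A p \<Longrightarrow> tens_add A S T p v = S p v + T p v"
  and tens_scale_apply [simp]: "v \<in> fibre A p \<Longrightarrow> tens_scale A c T p v = c *\<^sub>R T p v"
  and tens_comp_apply [simp]: "v \<in> fibre A p \<Longrightarrow> tens_comp A S T p v = S p (T p v)"
  by (auto simp: tens_id_def tens_zero_def tens_add_def tens_scale_def tens_comp_def compose_def)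

lemma tensor11_id: "tensor11 A (tens_id A)"
proof (rule tensor11I)
  show "smooth_in_frame A U e (\<lambda>p. tens_id A p (e j p))" if "(U, e) \<in> frames A" "j < rk" for U e j
    by (rule smooth_in_frame_cong[OF _ smooth_in_frame_frame[OF frame_open]])
       (use that in \<open>auto simp: frame_in_fibre\<close>)
qed (auto simp: tens_id_def)

lemma tensor11_scale:
  assumes "tensor11 A T" shows "tensor11 A (tens_scale A c T)"
proof (rule tensor11I)
  show "smooth_in_frame A U e (\<lambda>p. tens_scale A c T p (e j p))" if "(U, e) \<in> frames A" "j < rk" for U e j
  proof (rule smooth_in_frame_cong)
    show "smooth_in_frame A U e (\<lambda>p. c *\<^sub>R T p (e j p))"
      using that assms by (intro smooth_in_frame_scale tensor_frame frame_open)
  qed (use that in \<open>simp add: frame_in_fibre\<close>)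
qed (use assms in \<open>auto simp: tens_scale_def tensor_add tensor_scale algebra_simps\<close>)

lemma tensor11_add:
  assumes "tensor11 A S" "tensor11 A T" shows "tensor11 A (tens_add A S T)"
proof (rule tensor11I)
  show "smooth_in_frame A U e (\<lambda>p. tens_add A S T p (e j p))" if "(U, e) \<in> frames A" "j < rk" for U e j
  proof (rule smooth_in_frame_cong)
    show "smooth_in_frame A U e (\<lambda>p. S p (e j p) + T p (e j p))"
      using that assms by (intro smooth_in_frame_add tensor_frame frame_open)
  qed (use that in \<open>simp add: frame_in_fibre\<close>)
qed (use assms in \<open>auto simp: tens_add_def tensor_add tensor_scale algebra_simps\<close>)

lemma tensor11_comp:
  assumes "tensor11 A S" "tensor11 A T" shows "tensor11 A (tens_comp A S T)"
proof (rule tensor11I)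
  show "smooth_in_frame A U e (\<lambda>p. tens_comp A S T p (e j p))" if "(U, e) \<in> frames A" "j < rk" for U e j
  proof (rule smooth_in_frame_cong)
    show "smooth_in_frame A U e (\<lambda>p. S p (T p (e j p)))"
      using assms that by (intro smooth_in_frame_tensor[OF assms(1)] tensor_frame)
  qed (use that in \<open>simp add: frame_in_fibre\<close>)
qed (use assms in \<open>auto simp: tens_comp_def compose_def tensor_add tensor_scale\<close>)

lemma tens_app_add:
  assumes "tensor11 A T" "X \<in> Sec A" "Y \<in> Sec A"
  shows "tens_app T (\<lambda>p. X p + Y p) = (\<lambda>p. tens_app T X p + tens_app T Y p)"
  using assms by (auto simp: tens_app_def tensor_add)

lemma tens_app_scale:
  assumes "tensor11 A T" "X \<in> Sec A"
  shows "tens_app T (\<lambda>p. c *\<^sub>R X p) = (\<lambda>p. c *\<^sub>R tens_app T X p)"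
  using assms by (auto simp: tens_app_def tensor_scale)

lemma Sec_minus: "X \<in> Sec A \<Longrightarrow> (\<lambda>p. - X p) \<in> Sec A"
  using Sec_scale[of X "- 1"] by simp

end

section \<open>Courant algebroids\<close>

locale courant_alg =
  fixes A :: "('m::{t2_space,second_countable_topology}, 'e::real_inner, 'v::real_vector, 'z) courant_scheme"
  assumes courant: "courant_algebroid A"

sublocale courant_alg \<subseteq> smooth_vbundle A
  using courant by unfold_locales (simp add: courant_algebroid_def)

context courant_alg begin

abbreviation "g \<equiv> pairing A"
abbreviation cp (infixl "\<diamondop>" 70) where "X \<diamondop> Y \<equiv> cprod A X Y"

section \<open>Fibrewise linear algebra of the pairing\<close>

lemma metric: "nondegenerate_metric A g"
  using courant by (simp add: courant_algebroid_def)

lemma g_sym: "u \<in> fibre A p \<Longrightarrow> v \<in> fibre A p \<Longrightarrow> g p u v = g p v u"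
  using metric[unfolded nondegenerate_metric_def, THEN conjunct1] by blast

lemma g_add_left: "u \<in> fibre A p \<Longrightarrow> v \<in> fibre A p \<Longrightarrow> w \<in> fibre A p \<Longrightarrow> g p (u + v) w = g p u w + g p v w"
  and g_scale_left: "u \<in> fibre A p \<Longrightarrow> v \<in> fibre A p \<Longrightarrow> g p (c *\<^sub>R u) v = c * g p u v"
  using metric[unfolded nondegenerate_metric_def, THEN conjunct2] by simp_all

lemma g_nondeg: "u \<in> fibre A p \<Longrightarrow> (\<And>v. v \<in> fibre A p \<Longrightarrow> g p u v = 0) \<Longrightarrow> u = 0"
  using metric[unfolded nondegenerate_metric_def, THEN conjunct2] by simp

lemma g_frame: "(U, e) \<in> frames A \<Longrightarrow> i < rk \<Longrightarrow> j < rk \<Longrightarrow> smooth_fun_on A U (\<lambda>p. g p (e i p) (e j p))"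
  using metric unfolding nondegenerate_metric_def by (elim conjE) (drule (1) bspec, simp)

lemma g_add_right:
  "u \<in> fibre A p \<Longrightarrow> v \<in> fibre A p \<Longrightarrow> w \<in> fibre A p \<Longrightarrow> g p w (u + v) = g p w u + g p w v"
  using g_add_left[of u p v w] g_sym[of w p] by simp

lemma g_scale_right: "u \<in> fibre A p \<Longrightarrow> v \<in> fibre A p \<Longrightarrow> g p v (c *\<^sub>R u) = c * g p v u"
  using g_scale_left[of u p v c] g_sym[of v p] by simp

lemma g_diff_left:
  assumes "u \<in> fibre A p" "v \<in> fibre A p" "w \<in> fibre A p"
  shows "g p (u - v) w = g p u w - g p v w"
  using g_add_left[of u p "(- 1) *\<^sub>R v" w] g_scale_left[of v p w "- 1"] fibre_scale[of v p "- 1"] assms by simp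

lemma g_diff_right:
  "u \<in> fibre A p \<Longrightarrow> v \<in> fibre A p \<Longrightarrow> w \<in> fibre A p \<Longrightarrow> g p w (u - v) = g p w u - g p w v"
  using g_diff_left[of u p v w] g_sym[of w p] by simp

lemma g_zero_left: "v \<in> fibre A p \<Longrightarrow> g p 0 v = 0"
  using g_scale_left[OF fibre_zero, of v p 0] by simp

lemma g_sum_left:
  assumes "\<And>i. i \<in> I \<Longrightarrow> u i \<in> fibre A p" "v \<in> fibre A p"
  shows "g p (\<Sum>i\<in>I. c i *\<^sub>R u i) v = (\<Sum>i\<in>I. c i * g p (u i) v)"
  using assms(1)
proof (induction I rule: infinite_finite_induct)
  case (insert i I)
  then show ?case using assms(2) by (simp add: g_add_left g_scale_left fibre_sum)
qed (simp_all add: g_zero_left assms(2))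

lemma g_sum_right:
  assumes "\<And>i. i \<in> I \<Longrightarrow> u i \<in> fibre A p" "v \<in> fibre A p"
  shows "g p v (\<Sum>i\<in>I. c i *\<^sub>R u i) = (\<Sum>i\<in>I. c i * g p v (u i))"
proof -
  have "(\<Sum>i\<in>I. c i *\<^sub>R u i) \<in> fibre A p" using assms by (intro fibre_sum fibre_scale)
  then have "g p v (\<Sum>i\<in>I. c i *\<^sub>R u i) = g p (\<Sum>i\<in>I. c i *\<^sub>R u i) v"
    using g_sym assms(2) by blast
  also have "\<dots> = (\<Sum>i\<in>I. c i * g p (u i) v)" by (rule g_sum_left[OF assms])
  also have "\<dots> = (\<Sum>i\<in>I. c i * g p v (u i))"
    using assms by (intro sum.cong refl arg_cong2[of _ _ _ _ "(*)"] g_sym)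
  finally show ?thesis .
qed

lemma g_eqI:
  assumes "u \<in> fibre A p" "v \<in> fibre A p" "\<And>w. w \<in> fibre A p \<Longrightarrow> g p u w = g p v w"
  shows "u = v"
  using g_nondeg[of "u - v" p] assms by (simp add: g_diff_left)

lemma smooth_pairing:
  assumes U: "(U, e) \<in> frames A" and X: "smooth_in_frame A U e X" and Y: "smooth_in_frame A U e Y"
  shows "smooth_fun_on A U (\<lambda>p. g p (X p) (Y p))"
proof -
  obtain c where c: "\<And>i. i < rk \<Longrightarrow> smooth_fun_on A U (c i)"
      "\<And>p. p \<in> U \<Longrightarrow> X p = (\<Sum>i<rk. c i p *\<^sub>R e i p)"
    using X by (rule smooth_in_frameE) (rule that)
  obtain d where d: "\<And>i. i < rk \<Longrightarrow> smooth_fun_on A U (d i)"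
      "\<And>p. p \<in> U \<Longrightarrow> Y p = (\<Sum>i<rk. d i p *\<^sub>R e i p)"
    using Y by (rule smooth_in_frameE) (rule that)
  have eq: "(\<Sum>i<rk. c i p * (\<Sum>j<rk. d j p * g p (e i p) (e j p))) = g p (X p) (Y p)" if "p \<in> U" for p
  proof -
    have e: "e i p \<in> fibre A p" if "i \<in> {..<rk}" for i
      using frame_in_fibre[OF U \<open>p \<in> U\<close>] that by simp
    have w: "(\<Sum>i<rk. d i p *\<^sub>R e i p) \<in> fibre A p" using e by (intro fibre_sum fibre_scale)
    have "g p (X p) (Y p) = (\<Sum>i<rk. c i p * g p (e i p) (Y p))"
      unfolding c(2)[OF that] d(2)[OF that] by (rule g_sum_left[OF e w])
    also have "\<dots> = (\<Sum>i<rk. c i p * (\<Sum>j<rk. d j p * g p (e i p) (e j p)))"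
      unfolding d(2)[OF that]
      by (intro sum.cong refl arg_cong2[of _ _ _ _ "(*)"] g_sum_right[OF e e])
    finally show ?thesis ..
  qed
  have sm: "smooth_fun_on A U (\<lambda>p. \<Sum>i<rk. c i p * (\<Sum>j<rk. d j p * g p (e i p) (e j p)))"
    using frame_open[OF U] c d g_frame[OF U]
    by (intro smooth_fun_on_sum smooth_fun_on_mult) auto
  show ?thesis by (rule smooth_fun_on_cong[OF frame_open[OF U] eq sm])
qed

text \<open>Needed because tangent vectors are linear only on \<open>smooth_funs\<close>, so the
  compatibility identities can be polarised only for smooth functions.\<close>

lemma smooth_inner:
  assumes "X \<in> Sec A" "Y \<in> Sec A"
  shows "(\<lambda>p. g p (X p) (Y p)) \<in> smooth_funs A"
  unfolding smooth_funs_def mem_Collect_eq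
proof (rule smooth_fun_on_local)
  fix p :: 'm
  obtain U e where U: "(U, e) \<in> frames A" "p \<in> U" by (rule frame_cover)
  then show "\<exists>V. open V \<and> p \<in> V \<and> smooth_fun_on A V (\<lambda>p. g p (X p) (Y p))"
    using frame_open[OF U(1)] smooth_pairing[OF U(1) Sec_smooth Sec_smooth, OF assms(1) U(1) assms(2) U(1)]
    by (intro exI[of _ U]) simp
qed

text \<open>A functional with smooth values on a frame is represented by a smooth local section: its
  coefficients solve the linear system of the Gram matrix of the frame.\<close>

lemma smooth_riesz:
  assumes U: "(U, e) \<in> frames A" and b: "\<And>k. k < rk \<Longrightarrow> smooth_fun_on A U (b k)"
  shows "\<exists>W. smooth_in_frame A U e W \<and>
    (\<forall>p\<in>U. W p \<in> fibre A p \<and> (\<forall>k<rk. g p (e k p) (W p) = b k p))"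
proof -
  have e: "e i p \<in> fibre A p" if "p \<in> U" "i \<in> {..<rk}" for i p
    using frame_in_fibre[OF U] that by simp
  have eq: "g p (e k p) (\<Sum>i<rk. v i *\<^sub>R e i p) = (\<Sum>i<rk. g p (e k p) (e i p) * v i)"
    if "p \<in> U" "k < rk" for p k v
    using g_sum_right[OF e[OF that(1)] e[OF that(1), of k], where I = "{..<rk}" and c = v] that(2)
    by (simp add: mult.commute)
  \<comment> \<open>A kernel vector of the Gram matrix yields a vector orthogonal to the whole
    fibre, hence 0 by nondegeneracy.\<close>
  have nondeg: "v i = 0" if p: "p \<in> U" and v: "\<And>k. k < rk \<Longrightarrow> (\<Sum>i<rk. g p (e k p) (e i p) * v i) = 0"
    and i: "i < rk" for p v i
  proof -
    have w: "(\<Sum>i<rk. v i *\<^sub>R e i p) \<in> fibre A p"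
      using e p by (intro fibre_sum fibre_scale)
    have "(\<Sum>i<rk. v i *\<^sub>R e i p) = 0"
    proof (rule g_nondeg[OF w])
      fix x assume x: "x \<in> fibre A p"
      obtain a where a: "x = (\<Sum>k<rk. a k *\<^sub>R e k p)" using frame_expand[OF U p x] by blast
      have "g p (\<Sum>i<rk. v i *\<^sub>R e i p) x = g p x (\<Sum>i<rk. v i *\<^sub>R e i p)"
        by (rule g_sym[OF w x])
      also have "\<dots> = (\<Sum>k<rk. a k * g p (e k p) (\<Sum>i<rk. v i *\<^sub>R e i p))"
        unfolding a by (rule g_sum_left[OF e[OF p] w])
      also have "\<dots> = 0" using eq[OF p] v by simp
      finally show "g p (\<Sum>i<rk. v i *\<^sub>R e i p) x = 0" .
    qed
    then show ?thesis using frame_unique[OF U p, of v "\<lambda>_. 0"] i by simp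
  qed
  obtain c where c: "\<And>i. i < rk \<Longrightarrow> smooth_fun_on A U (c i)"
      "\<And>p k. p \<in> U \<Longrightarrow> k < rk \<Longrightarrow> (\<Sum>i<rk. g p (e k p) (e i p) * c i p) = b k p"
  proof (rule smooth_linear_system[OF frame_open[OF U], of rk "\<lambda>k i p. g p (e k p) (e i p)" b])
    show "smooth_fun_on A U (\<lambda>p. g p (e i p) (e j p))" if "i < rk" "j < rk" for i j
      using g_frame[OF U that] .
  qed (use b nondeg that in blast)+
  have "smooth_in_frame A U e (\<lambda>p. \<Sum>i<rk. c i p *\<^sub>R e i p)"
    by (rule smooth_in_frame_combination[of U "{..<rk}" c e e])
       (simp_all add: c(1) frame_open[OF U] smooth_in_frame_frame)
  moreover have "(\<Sum>i<rk. c i p *\<^sub>R e i p) \<in> fibre A p" if "p \<in> U" for p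
    using e[OF that] by (intro fibre_sum fibre_scale)
  ultimately show ?thesis
    by (intro exI[of _ "\<lambda>p. \<Sum>i<rk. c i p *\<^sub>R e i p"]) (simp add: eq c(2))
qed

text \<open>Justifies the definite description in \<open>adjoint_tensor\<close>. Existence is Riesz
  representation of the functional \<open>u\<close> to \<open>g p (T p u) v\<close>; uniqueness is
  nondegeneracy.\<close>

lemma adjoint_ex1:
  assumes T: "tensor11 A T" and v: "v \<in> fibre A p"
  shows "\<exists>!w. w \<in> fibre A p \<and> (\<forall>u\<in>fibre A p. g p (T p u) v = g p u w)"
proof -
  obtain U e where U: "(U, e) \<in> frames A" "p \<in> U" by (rule frame_cover)
  have e: "e k p \<in> fibre A p" if "k \<in> {..<rk}" for k using frame_in_fibre[OF U] that by simp
  \<comment> \<open>The data are frozen at \<open>p\<close> and constant in \<open>q\<close>, so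
    their smoothness is trivial; only the value \<open>W p\<close> is used.\<close>
  obtain W where W: "\<forall>q\<in>U. W q \<in> fibre A q \<and> (\<forall>k<rk. g q (e k q) (W q) = g p (T p (e k p)) v)"
    using smooth_riesz[where b = "\<lambda>k q. g p (T p (e k p)) v",
      OF U(1) smooth_fun_on_const[OF frame_open[OF U(1)]]] by (elim exE conjE)
  then have Wp: "W p \<in> fibre A p" "\<And>k. k < rk \<Longrightarrow> g p (e k p) (W p) = g p (T p (e k p)) v"
    using U(2) by auto
  have "g p (T p u) v = g p u (W p)" if "u \<in> fibre A p" for u
  proof -
    obtain a where a: "u = (\<Sum>i<rk. a i *\<^sub>R e i p)" using frame_expand[OF U \<open>u \<in> fibre A p\<close>] by blast
    have "g p (T p u) v = g p (\<Sum>i<rk. a i *\<^sub>R T p (e i p)) v"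
      unfolding a by (rule arg_cong[OF tensor_sum[OF T e]])
    also have "\<dots> = (\<Sum>i<rk. a i * g p (T p (e i p)) v)"
      using e T v by (intro g_sum_left) simp_all
    also have "\<dots> = (\<Sum>i<rk. a i * g p (e i p) (W p))" using Wp(2) by simp
    also have "\<dots> = g p u (W p)" unfolding a using e Wp(1) by (intro g_sum_left[symmetric])
    finally show ?thesis .
  qed
  moreover have "w = w'" if "w \<in> fibre A p" "w' \<in> fibre A p" "\<forall>u\<in>fibre A p. g p u w = g p u w'" for w w'
    using that g_sym by (intro g_eqI[of w p w']) auto
  ultimately show ?thesis using Wp(1) by (intro ex1I[of _ "W p"]) auto
qed

lemma adjoint_fibre: "tensor11 A T \<Longrightarrow> v \<in> fibre A p \<Longrightarrow> adjoint_tensor A T p v \<in> fibre A p"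
  and adjoint_g: "tensor11 A T \<Longrightarrow> v \<in> fibre A p \<Longrightarrow> u \<in> fibre A p \<Longrightarrow>
    g p (T p u) v = g p u (adjoint_tensor A T p v)"
  using theI'[OF adjoint_ex1, of T v p] by (auto simp: adjoint_tensor_def)

lemma adjoint_eqI:
  assumes "tensor11 A T" "v \<in> fibre A p" "w \<in> fibre A p" "\<And>u. u \<in> fibre A p \<Longrightarrow> g p (T p u) v = g p u w"
  shows "adjoint_tensor A T p v = w"
proof -
  have "(THE w. w \<in> fibre A p \<and> (\<forall>u\<in>fibre A p. g p (T p u) v = g p u w)) = w"
    by (rule the1_equality[OF adjoint_ex1[OF assms(1,2)]]) (use assms in blast)
  then show ?thesis using assms(2) by (simp add: adjoint_tensor_def)
qed

text \<open>Linearity follows from uniqueness of the adjoint vector. For smoothness,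
  \<open>smooth_riesz\<close> supplies a smooth section \<open>W\<close> which uniqueness identifies
  with the adjoint applied to \<open>e j\<close>.\<close>

lemma tensor11_adjoint:
  assumes T: "tensor11 A T" shows "tensor11 A (adjoint_tensor A T)"
proof (rule tensor11I)
  fix p u v assume "u \<in> fibre A p" "v \<in> fibre A p"
  then show "adjoint_tensor A T p (u + v) = adjoint_tensor A T p u + adjoint_tensor A T p v"
    by (intro adjoint_eqI T) (simp_all add: adjoint_fibre T g_add_right flip: adjoint_g)
next
  fix p u and c :: real assume "u \<in> fibre A p"
  then show "adjoint_tensor A T p (c *\<^sub>R u) = c *\<^sub>R adjoint_tensor A T p u"
    by (intro adjoint_eqI T) (simp_all add: adjoint_fibre T g_scale_right flip: adjoint_g)
next
  fix U e j assume U: "(U, e) \<in> frames A" and j: "j < rk"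
  let ?b = "\<lambda>k p. g p (T p (e k p)) (e j p)"
  have "smooth_fun_on A U (?b k)" if "k < rk" for k
    by (rule smooth_pairing[OF U tensor_frame[OF T U that] smooth_in_frame_frame[OF frame_open[OF U] j]])
  then have "\<exists>W. smooth_in_frame A U e W \<and>
      (\<forall>p\<in>U. W p \<in> fibre A p \<and> (\<forall>k<rk. g p (e k p) (W p) = ?b k p))"
    by (rule smooth_riesz[where b = ?b, OF U])
  then obtain W where W: "smooth_in_frame A U e W"
      "\<forall>p\<in>U. W p \<in> fibre A p \<and> (\<forall>k<rk. g p (e k p) (W p) = ?b k p)"
    by (elim exE conjE)
  show "smooth_in_frame A U e (\<lambda>p. adjoint_tensor A T p (e j p))"
  proof (rule smooth_in_frame_cong[OF _ W(1)])
    fix p assume p: "p \<in> U"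
    have e: "e k p \<in> fibre A p" if "k \<in> {..<rk}" for k using frame_in_fibre[OF U p] that by simp
    have Wp: "W p \<in> fibre A p" "\<And>k. k < rk \<Longrightarrow> g p (e k p) (W p) = g p (T p (e k p)) (e j p)"
      using W(2) p by auto
    show "W p = adjoint_tensor A T p (e j p)"
    proof (rule adjoint_eqI[OF T _ Wp(1), symmetric])
      show ej: "e j p \<in> fibre A p" using e j by simp
      fix u assume u: "u \<in> fibre A p"
      obtain a where a: "u = (\<Sum>i<rk. a i *\<^sub>R e i p)" using frame_expand[OF U p u] by blast
      have "g p (T p u) (e j p) = g p (\<Sum>i<rk. a i *\<^sub>R T p (e i p)) (e j p)"
        unfolding a by (rule arg_cong[OF tensor_sum[OF T e]])
      also have "\<dots> = (\<Sum>i<rk. a i * g p (T p (e i p)) (e j p))"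
        using e T ej by (intro g_sum_left) simp_all
      also have "\<dots> = (\<Sum>i<rk. a i * g p (e i p) (W p))" using Wp(2) by simp
      also have "\<dots> = g p u (W p)" unfolding a using e Wp(1) by (intro g_sum_left[symmetric])
      finally show "g p (T p u) (e j p) = g p u (W p)" .
    qed
  qed
qed (rule adjoint_fibre[OF T], assumption, simp add: adjoint_tensor_def)

section \<open>The product and the polarised compatibility identities\<close>

lemma product_Sec [simp]: "X \<in> Sec A \<Longrightarrow> Y \<in> Sec A \<Longrightarrow> X \<diamondop> Y \<in> Sec A"
  and product_add_left: "X \<in> Sec A \<Longrightarrow> Y \<in> Sec A \<Longrightarrow> Z \<in> Sec A \<Longrightarrow>
    (\<lambda>p. X p + Y p) \<diamondop> Z = (\<lambda>p. (X \<diamondop> Z) p + (Y \<diamondop> Z) p)"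
  and product_add_right: "X \<in> Sec A \<Longrightarrow> Y \<in> Sec A \<Longrightarrow> Z \<in> Sec A \<Longrightarrow>
    Z \<diamondop> (\<lambda>p. X p + Y p) = (\<lambda>p. (Z \<diamondop> X) p + (Z \<diamondop> Y) p)"
  and product_scale_left: "X \<in> Sec A \<Longrightarrow> Y \<in> Sec A \<Longrightarrow> (\<lambda>p. c *\<^sub>R X p) \<diamondop> Y = (\<lambda>p. c *\<^sub>R (X \<diamondop> Y) p)"
  and product_scale_right: "X \<in> Sec A \<Longrightarrow> Y \<in> Sec A \<Longrightarrow> X \<diamondop> (\<lambda>p. c *\<^sub>R Y p) = (\<lambda>p. c *\<^sub>R (X \<diamondop> Y) p)"
  using courant by (simp_all add: courant_algebroid_def leibniz_product_def)

definition der :: "('m \<Rightarrow> 'v) \<Rightarrow> ('m \<Rightarrow> real) \<Rightarrow> 'm \<Rightarrow> real" where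
  "der X f p = anchor A p (X p) f"

lemma der_add: "X \<in> Sec A \<Longrightarrow> f \<in> smooth_funs A \<Longrightarrow> h \<in> smooth_funs A \<Longrightarrow>
    der X (\<lambda>q. f q + h q) p = der X f p + der X h p"
  and der_scale: "X \<in> Sec A \<Longrightarrow> f \<in> smooth_funs A \<Longrightarrow> der X (\<lambda>q. c * f q) p = c * der X f p"
proof -
  have *: "anchor A p (X p) \<in> tangent_space A p" if "X \<in> Sec A"
    using courant that by (auto simp: courant_algebroid_def bundle_map_to_tangent_def)
  show "X \<in> Sec A \<Longrightarrow> f \<in> smooth_funs A \<Longrightarrow> h \<in> smooth_funs A \<Longrightarrow>
      der X (\<lambda>q. f q + h q) p = der X f p + der X h p"
    using * by (auto simp: der_def tangent_space_def)
  show "X \<in> Sec A \<Longrightarrow> f \<in> smooth_funs A \<Longrightarrow> der X (\<lambda>q. c * f q) p = c * der X f p"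
    using * by (auto simp: der_def tangent_space_def)
qed

definition inn :: "('m \<Rightarrow> 'v) \<Rightarrow> ('m \<Rightarrow> 'v) \<Rightarrow> 'm \<Rightarrow> real" where
  "inn X Y = (\<lambda>p. g p (X p) (Y p))"

lemma compat:
  assumes "X \<in> Sec A" "Y \<in> Sec A"
  shows "der X (inn Y Y) p = 2 * g p (X p) ((Y \<diamondop> Y) p)"
    "der X (inn Y Y) p = 2 * g p ((X \<diamondop> Y) p) (Y p)"
  using courant assms unfolding courant_algebroid_def pairing_compatible_def der_def inn_def by blast+

text \<open>Both compatibility identities are quadratic in the section; this expansion turns them
  into the bilinear forms \<open>compat_sym\<close> and \<open>compat_inv\<close>.\<close>

lemma der_polarise:
  assumes "X \<in> Sec A" "Y \<in> Sec A" "Z \<in> Sec A"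
  shows "der X (inn (\<lambda>p. Y p + Z p) (\<lambda>p. Y p + Z p)) p = der X (inn Y Y) p + 2 * der X (inn Y Z) p + der X (inn Z Z) p"
proof -
  have [simp]: "inn Y Y \<in> smooth_funs A" "inn Y Z \<in> smooth_funs A" "inn Z Z \<in> smooth_funs A"
    using assms smooth_inner by (auto simp: inn_def)
  have "inn (\<lambda>p. Y p + Z p) (\<lambda>p. Y p + Z p) = (\<lambda>p. (inn Y Y p + 2 * inn Y Z p) + inn Z Z p)"
    using assms by (auto simp: inn_def g_add_left g_add_right g_sym[of "Z p" p "Y p" for p])
  moreover have "(\<lambda>p. 2 * inn Y Z p) \<in> smooth_funs A"
    using smooth_inner[OF Sec_scale[OF assms(2)] assms(3), of 2] assms
    by (simp add: inn_def g_scale_left)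
  moreover from this have "(\<lambda>p. inn Y Y p + 2 * inn Y Z p) \<in> smooth_funs A"
    using smooth_fun_on_add[of UNIV "inn Y Y"] \<open>inn Y Y \<in> smooth_funs A\<close> by (simp add: smooth_funs_def)
  ultimately show ?thesis using assms(1) by (simp add: der_add der_scale)
qed

lemma compat_sym:
  assumes "X \<in> Sec A" "Y \<in> Sec A" "Z \<in> Sec A"
  shows "der X (inn Y Z) p = g p (X p) ((Y \<diamondop> Z) p + (Z \<diamondop> Y) p)"
  using der_polarise[OF assms, of p] compat(1)[OF assms(1) Sec_add[OF assms(2,3)], of p]
    compat(1)[OF assms(1,2), of p] compat(1)[OF assms(1,3), of p] assms
  by (simp add: product_add_left product_add_right Sec_add g_add_right)

lemma compat_inv:
  assumes "X \<in> Sec A" "Y \<in> Sec A" "Z \<in> Sec A"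
  shows "der X (inn Y Z) p = g p ((X \<diamondop> Y) p) (Z p) + g p (Y p) ((X \<diamondop> Z) p)"
  using der_polarise[OF assms, of p] compat(2)[OF assms(1) Sec_add[OF assms(2,3)], of p]
    compat(2)[OF assms(1,2), of p] compat(2)[OF assms(1,3), of p] assms g_sym[of "Y p" p "(X \<diamondop> Z) p"]
  by (simp add: product_add_right g_add_right g_add_left)

lemma sec_eqI:
  assumes "u \<in> fibre A p" "v \<in> fibre A p" "\<And>X. X \<in> Sec A \<Longrightarrow> g p (X p) u = g p (X p) v"
  shows "u = v"
proof (rule g_eqI[OF assms(1,2)])
  fix w assume w: "w \<in> fibre A p"
  obtain X where "X \<in> Sec A" "X p = w" using section_through[OF w] .
  then show "g p u w = g p v w" using assms g_sym w by metis
qed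

text \<open>By \<open>compat_sym\<close> the symmetric part of the product pairs with
  \<open>X\<close> to the derivative of \<open>inn Y Z\<close> along \<open>X\<close>, so it depends
  on \<open>Y\<close> and \<open>Z\<close> only through that function. This is how \<open>N\<close>
  is later moved from one factor to the other.\<close>

lemma square_symmetric_part:
  assumes "Y \<in> Sec A" "Z \<in> Sec A" "Y' \<in> Sec A" "Z' \<in> Sec A" "inn Y Z = inn Y' Z'"
  shows "(Y \<diamondop> Z) p + (Z \<diamondop> Y) p = (Y' \<diamondop> Z') p + (Z' \<diamondop> Y') p"
proof (rule sec_eqI)
  fix X assume "X \<in> Sec A"
  then show "g p (X p) ((Y \<diamondop> Z) p + (Z \<diamondop> Y) p) = g p (X p) ((Y' \<diamondop> Z') p + (Z' \<diamondop> Y') p)"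
    using compat_sym[of X Y Z p] compat_sym[of X Y' Z' p] assms by simp
qed (use assms in simp_all)

lemma product_minus_left:
  "X \<in> Sec A \<Longrightarrow> Y \<in> Sec A \<Longrightarrow> (\<lambda>p. - X p) \<diamondop> Y = (\<lambda>p. - (X \<diamondop> Y) p)"
  using product_scale_left[of X Y "- 1"] by simp

lemma product_minus_right:
  "X \<in> Sec A \<Longrightarrow> Y \<in> Sec A \<Longrightarrow> X \<diamondop> (\<lambda>p. - Y p) = (\<lambda>p. - (X \<diamondop> Y) p)"
  using product_scale_right[of X Y "- 1"] by simp

lemma product_diff_right:
  "X \<in> Sec A \<Longrightarrow> Y \<in> Sec A \<Longrightarrow> Z \<in> Sec A \<Longrightarrow>
    Z \<diamondop> (\<lambda>p. X p - Y p) = (\<lambda>p. (Z \<diamondop> X) p - (Z \<diamondop> Y) p)"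
  using product_add_right[of X "\<lambda>p. - Y p" Z] by (simp add: Sec_minus product_minus_right)

lemma irreducibleD:
  assumes "irreducible_courant A" "tensor11 A T"
    and "\<And>X Z. X \<in> Sec A \<Longrightarrow> Z \<in> Sec A \<Longrightarrow> X \<diamondop> tens_app T Z = tens_app T (X \<diamondop> Z)"
    and "\<And>Y. Y \<in> Sec A \<Longrightarrow> tens_app T (Y \<diamondop> Y) = tens_app T Y \<diamondop> Y"
  obtains l where "T = tens_scale A l (tens_id A)"
proof -
  have "T \<in> {tens_scale A l (tens_id A) | l. True}"
    using assms unfolding irreducible_courant_def by blast
  then show ?thesis using that by blast
qed

lemma g_minus_right: "u \<in> fibre A p \<Longrightarrow> v \<in> fibre A p \<Longrightarrow> g p v (- u) = - g p v u"
  using g_scale_right[of u p v "- 1"] by simp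

end

section \<open>Courant-Nijenhuis tensors\<close>

locale courant_nijenhuis = courant_alg A
  for A :: "('m::{t2_space,second_countable_topology}, 'e::real_inner, 'v::real_vector, 'z) courant_scheme" +
  fixes N :: "'m \<Rightarrow> 'v \<Rightarrow> 'v"
  assumes cn: "courant_nijenhuis_tensor A N"
begin

section \<open>The commutator of \<open>N\<close> with left multiplication\<close>

abbreviation "N' \<equiv> adjoint_tensor A N"
abbreviation "n \<equiv> tens_app N"
abbreviation "n' \<equiv> tens_app N'"

lemma tN [simp]: "tensor11 A N"
  using cn by (simp add: courant_nijenhuis_tensor_def nijenhuis_tensor_def)

lemma tN' [simp]: "tensor11 A N'"
  by (simp add: tensor11_adjoint)

lemma nSec [simp]: "X \<in> Sec A \<Longrightarrow> n X \<in> Sec A" "X \<in> Sec A \<Longrightarrow> n' X \<in> Sec A"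
  by (simp_all add: tens_app_Sec)

lemma n_apply: "n X p = N p (X p)" "n' X p = N' p (X p)"
  by (simp_all add: tens_app_def)

lemma adj: "u \<in> fibre A p \<Longrightarrow> v \<in> fibre A p \<Longrightarrow> g p (N p u) v = g p u (N' p v)"
  by (simp add: adjoint_g)

text \<open>If \<open>X \<diamondop> _\<close> is read as a Lie derivative, this is the Lie
  derivative of \<open>N\<close> along \<open>X\<close>. It is also the part of the contracted
  product left after removing \<open>n X \<diamondop> Y\<close>.\<close>

definition C :: "('m \<Rightarrow> 'v) \<Rightarrow> ('m \<Rightarrow> 'v) \<Rightarrow> 'm \<Rightarrow> 'v" where
  "C X Y p = (X \<diamondop> n Y) p - N p ((X \<diamondop> Y) p)"

lemma C_fibre [simp]: "X \<in> Sec A \<Longrightarrow> Y \<in> Sec A \<Longrightarrow> C X Y p \<in> fibre A p"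
  by (simp add: C_def)

lemma contracted_eq: "contracted A N X Y p = (n X \<diamondop> Y) p + C X Y p"
  by (simp add: contracted_def C_def n_apply)

lemma C_add: "X \<in> Sec A \<Longrightarrow> Y \<in> Sec A \<Longrightarrow> Z \<in> Sec A \<Longrightarrow> C X (\<lambda>p. Y p + Z p) p = C X Y p + C X Z p"
  by (simp add: C_def tens_app_add product_add_right tensor_add)

lemma C_scale: "X \<in> Sec A \<Longrightarrow> Y \<in> Sec A \<Longrightarrow> C X (\<lambda>p. c *\<^sub>R Y p) p = c *\<^sub>R C X Y p"
  by (simp add: C_def tens_app_scale product_scale_right tensor_scale scaleR_diff_right)

lemma C_diff:
  assumes "X \<in> Sec A" "Y \<in> Sec A" "Z \<in> Sec A"
  shows "C X (\<lambda>p. Y p - Z p) p = C X Y p - C X Z p"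
  using C_add[OF assms(1,2) Sec_scale[OF assms(3)], where c1 = "- 1"] C_scale[OF assms(1,3), of "- 1"]
  by simp

lemma compat_contracted:
  assumes "X \<in> Sec A" "Y \<in> Sec A"
  shows "der (n X) (inn Y Y) p = 2 * g p (X p) (contracted A N Y Y p)"
    "der (n X) (inn Y Y) p = 2 * g p (contracted A N X Y p) (Y p)"
  using cn assms
  unfolding courant_nijenhuis_tensor_def pairing_compatible_def der_def inn_def n_apply by blast+

text \<open>The second compatibility identity for the contracted product and that for the original
  product along \<open>n X\<close> compute the same derivative. Their difference is the pairing with
  \<open>C X Y\<close>; polarising gives \<open>C_skew\<close>.\<close>

lemma C_isotropic:
  assumes "X \<in> Sec A" "Y \<in> Sec A" shows "g p (C X Y p) (Y p) = 0"
  using compat_contracted(2)[OF assms, of p] compat(2)[of "n X" Y p] assms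
  by (simp add: contracted_eq g_add_left)

lemma C_skew:
  assumes "X \<in> Sec A" "Y \<in> Sec A" "Z \<in> Sec A" shows "g p (C X Y p) (Z p) = - g p (Y p) (C X Z p)"
  using C_isotropic[OF assms(1) Sec_add[OF assms(2,3)], of p] C_isotropic[OF assms(1,2), of p]
    C_isotropic[OF assms(1,3), of p] g_sym[of "C X Z p" p "Y p"] assms
  by (simp add: C_add g_add_left g_add_right)

text \<open>Apply \<open>compat_inv\<close> to both sides of
  \<open>inn (n' Y) Z = inn Y (n Z)\<close> and use \<open>C_skew\<close>. Thus left multiplication
  by \<open>X\<close> has with \<open>N'\<close> the commutator opposite to that with
  \<open>N\<close>, and it commutes with their sum.\<close>

lemma product_adjoint:
  assumes "X \<in> Sec A" "Y \<in> Sec A"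
  shows "(X \<diamondop> n' Y) p = N' p ((X \<diamondop> Y) p) - C X Y p"
proof (rule sec_eqI)
  fix Z assume Z: "Z \<in> Sec A"
  have inn: "inn (n' Y) Z = inn Y (n Z)"
    using assms Z g_sym[of "N' q (Y q)" q "Z q" for q] g_sym[of "Y q" q "N q (Z q)" for q]
    by (auto simp: inn_def n_apply adj)
  have 1: "g p ((X \<diamondop> n' Y) p) (Z p) + g p (N' p (Y p)) ((X \<diamondop> Z) p)
      = g p ((X \<diamondop> Y) p) (N p (Z p)) + g p (Y p) ((X \<diamondop> n Z) p)"
    using compat_inv[of X "n' Y" Z p] compat_inv[of X Y "n Z" p] assms Z by (simp add: inn n_apply)
  have 2: "g p (N' p (Y p)) ((X \<diamondop> Z) p) = g p (Y p) (N p ((X \<diamondop> Z) p))"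
    using assms Z adj[of "(X \<diamondop> Z) p" p "Y p"] g_sym[of "N' p (Y p)" p "(X \<diamondop> Z) p"]
      g_sym[of "Y p" p "N p ((X \<diamondop> Z) p)"] by simp
  have 3: "g p ((X \<diamondop> Y) p) (N p (Z p)) = g p (Z p) (N' p ((X \<diamondop> Y) p))"
    using assms Z adj[of "Z p" p "(X \<diamondop> Y) p"] g_sym[of "(X \<diamondop> Y) p" p "N p (Z p)"] by simp
  have 4: "g p (Y p) (C X Z p) = - g p (Z p) (C X Y p)"
    using C_skew[OF assms Z, of p] g_sym[of "Z p" p "C X Y p"] assms Z by simp
  have 5: "g p (Y p) (C X Z p) = g p (Y p) ((X \<diamondop> n Z) p) - g p (Y p) (N p ((X \<diamondop> Z) p))"
    using assms Z by (simp add: C_def g_diff_right)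
  have "g p (Z p) ((X \<diamondop> n' Y) p) = g p ((X \<diamondop> n' Y) p) (Z p)"
    using assms Z by (simp add: g_sym)
  with 1 2 3 4 5 show "g p (Z p) ((X \<diamondop> n' Y) p) = g p (Z p) (N' p ((X \<diamondop> Y) p) - C X Y p)"
    using assms Z by (simp add: g_diff_right)
qed (use assms in simp_all)

text \<open>The first compatibility identities for the two products both compute the derivative of
  \<open>inn Y Y\<close> along \<open>n X\<close>; moving \<open>N\<close> off \<open>X\<close>
  gives the adjoint.\<close>

lemma adjoint_square:
  assumes "Y \<in> Sec A" shows "N' p ((Y \<diamondop> Y) p) = (n Y \<diamondop> Y) p + C Y Y p"
proof (rule sec_eqI)
  fix X assume X: "X \<in> Sec A"
  show "g p (X p) (N' p ((Y \<diamondop> Y) p)) = g p (X p) ((n Y \<diamondop> Y) p + C Y Y p)"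
    using compat_contracted(1)[OF X assms, of p] compat(1)[of "n X" Y p] X assms
    by (simp add: contracted_eq n_apply adj)
qed (use assms in simp_all)

text \<open>The first equation combines \<open>product_adjoint\<close> and
  \<open>adjoint_square\<close>. The second follows because \<open>Y\<close> has the same pairing
  with \<open>n' Y\<close> as with \<open>n Y\<close>, so the symmetric parts agree.\<close>

lemma product_adjoint_self:
  assumes "Y \<in> Sec A"
  shows "(Y \<diamondop> n' Y) p = (n Y \<diamondop> Y) p" "(n' Y \<diamondop> Y) p = (Y \<diamondop> n Y) p"
proof -
  show 1: "(Y \<diamondop> n' Y) p = (n Y \<diamondop> Y) p"
    using product_adjoint[OF assms assms, of p] adjoint_square[OF assms, of p] by simp
  have "inn Y (n' Y) = inn Y (n Y)"
    using assms g_sym[of "Y q" q "N q (Y q)" for q] by (auto simp: inn_def n_apply adj)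
  then have "(Y \<diamondop> n' Y) p + (n' Y \<diamondop> Y) p = (Y \<diamondop> n Y) p + (n Y \<diamondop> Y) p"
    using assms by (intro square_symmetric_part) simp_all
  with 1 show "(n' Y \<diamondop> Y) p = (Y \<diamondop> n Y) p" by simp
qed

text \<open>In the first irreducibility condition the two commutators cancel. In the second, both
  sides reduce to \<open>n Y \<diamondop> Y\<close> plus \<open>Y \<diamondop> n Y\<close>.\<close>

lemma trace_scalar:
  assumes "irreducible_courant A"
  obtains l where "tens_add A N N' = tens_scale A l (tens_id A)"
proof (rule irreducibleD[OF assms])
  let ?D = "tens_add A N N'"
  have app: "tens_app ?D X = (\<lambda>p. n X p + n' X p)" if "X \<in> Sec A" for X
    using that by (auto simp: tens_app_def)
  show "tensor11 A ?D" by (simp add: tensor11_add)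
  show "X \<diamondop> tens_app ?D Z = tens_app ?D (X \<diamondop> Z)" if "X \<in> Sec A" "Z \<in> Sec A" for X Z
  proof
    fix p
    have "(X \<diamondop> tens_app ?D Z) p = (X \<diamondop> n Z) p + (X \<diamondop> n' Z) p"
      using that by (simp add: app product_add_right)
    then show "(X \<diamondop> tens_app ?D Z) p = tens_app ?D (X \<diamondop> Z) p"
      using that product_adjoint[OF that, of p] by (simp add: app n_apply C_def)
  qed
  show "tens_app ?D (Y \<diamondop> Y) = tens_app ?D Y \<diamondop> Y" if "Y \<in> Sec A" for Y
  proof
    fix p
    have "(tens_app ?D Y \<diamondop> Y) p = (n Y \<diamondop> Y) p + (n' Y \<diamondop> Y) p"
      using that by (simp add: app product_add_left)
    then show "tens_app ?D (Y \<diamondop> Y) p = (tens_app ?D Y \<diamondop> Y) p"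
      using that product_adjoint_self(2)[OF that, of p] adjoint_square[OF that, of p]
      by (simp add: app n_apply C_def)
  qed
qed (rule that)

section \<open>Vanishing torsion and the quadratic equation\<close>

lemma torsion_free:
  assumes "X \<in> Sec A" "Y \<in> Sec A"
  shows "(n X \<diamondop> n Y) p = N p (contracted A N X Y p)"
proof -
  have "torsion A N X Y = (\<lambda>p. 0)"
    using cn assms by (simp add: courant_nijenhuis_tensor_def nijenhuis_tensor_def)
  then have "torsion A N X Y p = 0" by simp
  then show ?thesis by (simp add: torsion_def n_apply)
qed

text \<open>Expanding the contracted product, the torsion is exactly the difference of the two
  sides.\<close>

lemma C_nijenhuis:
  assumes "X \<in> Sec A" "Y \<in> Sec A" shows "C (n X) Y p = N p (C X Y p)"
  using torsion_free[OF assms, of p] assms by (simp add: C_def[of "n X"] contracted_eq tensor_add)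

context
  fixes l :: real
  assumes trace: "tens_add A N N' = tens_scale A l (tens_id A)"
begin

lemma adjoint_eq:
  assumes "v \<in> fibre A p" shows "N' p v = l *\<^sub>R v - N p v"
proof -
  have "tens_add A N N' p v = tens_scale A l (tens_id A) p v" by (simp only: trace)
  then show ?thesis using assms by (simp add: algebra_simps)
qed

text \<open>Both \<open>C X\<close> and \<open>C (n X)\<close>, which is \<open>N\<close> after
  \<open>C X\<close>, are skew. Comparing them moves \<open>N\<close> to the argument of
  \<open>C X\<close> as \<open>N'\<close>, and \<open>N'\<close> is then replaced by
  \<open>l\<close> minus \<open>N\<close>.\<close>

lemma C_trace:
  assumes "X \<in> Sec A" "Y \<in> Sec A" shows "N p (C X Y p) + C X (n Y) p = l *\<^sub>R C X Y p"
proof -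
  have n': "n' Y = (\<lambda>q. l *\<^sub>R Y q - n Y q)"
    using assms by (auto simp: n_apply adjoint_eq)
  have "N p (C X Y p) = C X (n' Y) p"
  proof (rule sec_eqI)
    fix Z assume Z: "Z \<in> Sec A"
    have "g p (Z p) (N p (C X Y p)) = - g p (N p (C X Z p)) (Y p)"
      using C_skew[of "n X" Z Y p] assms Z by (simp add: C_nijenhuis)
    also have "\<dots> = - g p (C X Z p) (n' Y p)" using assms Z by (simp add: adj n_apply)
    also have "\<dots> = g p (Z p) (C X (n' Y) p)" using C_skew[of X Z "n' Y" p] assms Z by simp
    finally show "g p (Z p) (N p (C X Y p)) = g p (Z p) (C X (n' Y) p)" .
  qed (use assms in simp_all)
  also have "\<dots> = l *\<^sub>R C X Y p - C X (n Y) p"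
    unfolding n' using assms by (simp add: C_diff Sec_scale C_scale)
  finally show ?thesis by simp
qed

lemma norm_scalar:
  assumes "irreducible_courant A"
  obtains m where "tens_add A (tens_comp A N N) (tens_scale A (- l) N) = tens_scale A m (tens_id A)"
proof (rule irreducibleD[OF assms])
  let ?Q = "tens_add A (tens_comp A N N) (tens_scale A (- l) N)"
  show Q: "tensor11 A ?Q" by (simp add: tensor11_add tensor11_comp tensor11_scale)
  have Q_apply: "?Q p v = N p (N p v) - l *\<^sub>R N p v" if "v \<in> fibre A p" for p v
    using that by simp
  have app: "tens_app ?Q X = (\<lambda>p. n (n X) p - l *\<^sub>R n X p)" if "X \<in> Sec A" for X
    using that by (auto simp: tens_app_def)
  \<comment> \<open>Commuting \<open>X \<diamondop> _\<close> past \<open>?Q\<close> leaves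
    \<open>C X (n Z) + N (C X Z) - l C X Z\<close>, which vanishes by
    \<open>C_trace\<close>.\<close>
  have right: "(X \<diamondop> tens_app ?Q Z) p = ?Q p ((X \<diamondop> Z) p)" if X: "X \<in> Sec A" and Z: "Z \<in> Sec A" for X Z p
  proof -
    have "(X \<diamondop> tens_app ?Q Z) p = (X \<diamondop> n (n Z)) p - l *\<^sub>R (X \<diamondop> n Z) p"
      using X Z by (simp add: app product_diff_right product_scale_right Sec_scale)
    also have "(X \<diamondop> n (n Z)) p = C X (n Z) p + N p ((X \<diamondop> n Z) p)"
      by (simp add: C_def)
    also have nZ: "(X \<diamondop> n Z) p = C X Z p + N p ((X \<diamondop> Z) p)"
      by (simp add: C_def)
    finally show ?thesis
      using X Z by (simp add: C_trace[OF X Z, symmetric] tensor_add[OF tN] algebra_simps)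
  qed
  then show "X \<diamondop> tens_app ?Q Z = tens_app ?Q (X \<diamondop> Z)" if "X \<in> Sec A" "Z \<in> Sec A" for X Z
    using that by (auto simp: tens_app_def[of ?Q "X \<diamondop> Z"])
  show "tens_app ?Q (Y \<diamondop> Y) = tens_app ?Q Y \<diamondop> Y" if Y: "Y \<in> Sec A" for Y
  proof
    fix p
    let ?y = "(Y \<diamondop> Y) p"
    have QY: "tens_app ?Q Y \<in> Sec A" by (rule tens_app_Sec[OF Q Y])
    \<comment> \<open>Vanishing torsion and \<open>adjoint_square\<close> make the left-hand side
      \<open>N\<close> after \<open>N'\<close> applied to \<open>?y\<close>, and this composite is
      \<open>- ?Q\<close>.\<close>
    have nn: "(n Y \<diamondop> n Y) p = - ?Q p ?y"
      using Y by (simp add: torsion_free contracted_eq adjoint_square[OF Y, symmetric] adjoint_eq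
        tensor_diff[OF tN] tensor_scale[OF tN])
    \<comment> \<open>Since \<open>?Q\<close> is minus \<open>N'\<close> after \<open>N\<close>, the
      pairing of \<open>Y\<close> with \<open>?Q Y\<close> equals that of \<open>n Y\<close> with
      \<open>- n Y\<close>. The symmetric part is therefore twice \<open>?Q ?y\<close>;
      \<open>right\<close> accounts for one half and leaves \<open>?Q Y \<diamondop> Y\<close> for
      the other.\<close>
    have "(Y \<diamondop> tens_app ?Q Y) p + (tens_app ?Q Y \<diamondop> Y) p
        = (n Y \<diamondop> (\<lambda>q. - n Y q)) p + ((\<lambda>q. - n Y q) \<diamondop> n Y) p"
    proof (rule square_symmetric_part)
      show "inn Y (tens_app ?Q Y) = inn (n Y) (\<lambda>q. - n Y q)"
      proof
        fix q
        have "?Q q (Y q) = - N' q (N q (Y q))" using Y by (simp add: Q_apply adjoint_eq)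
        then have "inn Y (tens_app ?Q Y) q = - g q (Y q) (N' q (N q (Y q)))"
          using Y by (simp only: inn_def tens_app_def) (simp add: g_minus_right)
        also have "\<dots> = - g q (N q (Y q)) (N q (Y q))" using Y by (simp add: adj)
        also have "\<dots> = inn (n Y) (\<lambda>q. - n Y q) q"
          using Y by (simp add: inn_def n_apply g_minus_right)
        finally show "inn Y (tens_app ?Q Y) q = inn (n Y) (\<lambda>q. - n Y q) q" .
      qed
    qed (use Y QY in \<open>simp_all add: Sec_minus\<close>)
    also have "\<dots> = 2 *\<^sub>R ?Q p ?y"
      using Y by (simp only: product_minus_left product_minus_right nSec nn) (simp add: scaleR_2)
    finally show "tens_app ?Q (Y \<diamondop> Y) p = (tens_app ?Q Y \<diamondop> Y) p"
      using right[OF Y Y, of p] by (simp only: tens_app_def scaleR_2) simp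
  qed
qed (rule that)

end

section \<open>The span of the identity and \<open>N\<close>\<close>

definition lin :: "real \<Rightarrow> real \<Rightarrow> 'm \<Rightarrow> 'v \<Rightarrow> 'v" where
  "lin a b = tens_add A (tens_scale A a (tens_id A)) (tens_scale A b N)"

lemma lin_apply [simp]: "v \<in> fibre A p \<Longrightarrow> lin a b p v = a *\<^sub>R v + b *\<^sub>R N p v"
  by (simp add: lin_def)

lemma tensor11_lin [simp]: "tensor11 A (lin a b)"
  by (simp add: lin_def tensor11_add tensor11_scale tensor11_id)

lemma lin_unit: "tens_id A = lin 1 0" and lin_N: "N = lin 0 1"
  by (rule tensor_eqI; simp add: tensor11_id)+

lemma lin_add: "tens_add A (lin a b) (lin c d) = lin (a + c) (b + d)"
  by (rule tensor_eqI) (simp_all add: tensor11_add algebra_simps)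

lemma lin_scale: "tens_scale A c (lin a b) = lin (c * a) (c * b)"
  by (rule tensor_eqI) (simp_all add: tensor11_scale algebra_simps)

text \<open>The contracted product is linear in the tensor, and the identity contributes two copies
  of the product minus one.\<close>

lemma contracted_lin:
  assumes "X \<in> Sec A" "Y \<in> Sec A"
  shows "contracted A (lin a b) X Y = (\<lambda>p. a *\<^sub>R (X \<diamondop> Y) p + b *\<^sub>R contracted A N X Y p)"
proof -
  have app: "tens_app (lin a b) Z = (\<lambda>p. a *\<^sub>R Z p + b *\<^sub>R n Z p)" if "Z \<in> Sec A" for Z
    using that by (auto simp: tens_app_def)
  show ?thesis
    using assms
    by (auto simp: contracted_def app product_add_left product_add_right product_scale_left
        product_scale_right Sec_scale algebra_simps)
qed

context
  fixes l \<gamma> :: real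
  assumes trace: "tens_add A N N' = tens_scale A l (tens_id A)"
    and quadratic: "tens_add A (tens_add A (tens_comp A N N) (tens_scale A (- l) N))
      (tens_scale A \<gamma> (tens_id A)) = tens_zero A"
begin

lemma N_squared:
  assumes "v \<in> fibre A p" shows "N p (N p v) = l *\<^sub>R N p v - \<gamma> *\<^sub>R v"
proof -
  have "tens_add A (tens_add A (tens_comp A N N) (tens_scale A (- l) N))
      (tens_scale A \<gamma> (tens_id A)) p v = tens_zero A p v" by (simp only: quadratic)
  then show ?thesis using assms by (simp add: algebra_simps)
qed

text \<open>Multiplication modulo the polynomial t^2 - l t + \<gamma>: the square of
  \<open>N\<close> is eliminated by \<open>N_squared\<close>.\<close>

lemma lin_comp: "tens_comp A (lin a b) (lin c d) = lin (a * c - \<gamma> * (b * d)) (a * d + b * c + l * (b * d))"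
proof (rule tensor_eqI)
  fix p v assume v: "v \<in> fibre A p"
  then show "tens_comp A (lin a b) (lin c d) p v = lin (a * c - \<gamma> * (b * d)) (a * d + b * c + l * (b * d)) p v"
    by (simp add: tensor_add[OF tN] tensor_scale[OF tN] N_squared algebra_simps)
qed (simp_all add: tensor11_comp)

text \<open>The adjoint acts on the span as the conjugation sending \<open>N\<close> to
  \<open>l\<close> minus \<open>N\<close>.\<close>

lemma lin_adjoint: "adjoint_tensor A (lin a b) = lin (a + b * l) (- b)"
proof (rule tensor_eqI)
  fix p v assume v: "v \<in> fibre A p"
  then have eq: "lin (a + b * l) (- b) p v = a *\<^sub>R v + b *\<^sub>R N' p v"
    by (simp add: adjoint_eq[OF trace] algebra_simps)
  show "adjoint_tensor A (lin a b) p v = lin (a + b * l) (- b) p v"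
    unfolding eq by (rule adjoint_eqI)
      (use v in \<open>simp_all add: g_add_left g_add_right g_scale_left g_scale_right adj\<close>)
qed (simp_all add: tensor11_adjoint)

lemma involutive_algebra_eq: "involutive_algebra A N = {lin a b | a b. True}"
proof (intro equalityI subsetI)
  fix T assume "T \<in> involutive_algebra A N"
  then have "\<exists>a b. T = lin a b"
  proof induction
    case gen_id
    show ?case using lin_unit by blast
  next
    case gen_N
    show ?case using lin_N by blast
  next
    case (gen_add S T)
    then show ?case using lin_add by blast
  next
    case (gen_scale T c)
    then show ?case using lin_scale by blast
  next
    case (gen_comp S T)
    then show ?case using lin_comp by blast
  next
    case (gen_adjoint T)
    then show ?case using lin_adjoint by blast
  qed
  then show "T \<in> {lin a b | a b. True}" by simp
next
  fix T assume "T \<in> {lin a b | a b. True}"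
  then show "T \<in> involutive_algebra A N"
    by (auto simp: lin_def intro!: involutive_algebra.intros)
qed

lemma tens_power_eq: "\<exists>a b. tens_power A N k = lin a b"
proof (induction k)
  case 0
  show ?case using lin_unit by auto
next
  case (Suc k)
  then obtain a b where "tens_power A N k = lin a b" by blast
  \<comment> \<open>The factors 0 and 1 are the coordinates of \<open>N = lin 0 1\<close>, left
    unsimplified to match \<open>lin_comp\<close>.\<close>
  moreover have "tens_comp A N (lin a b) = lin (0 * a - \<gamma> * (1 * b)) (0 * b + 1 * a + l * (1 * b))"
    using lin_comp[of 0 1 a b] by (simp flip: lin_N)
  ultimately show ?case by auto
qed

end

end

text \<open>Triviality is made precise in two ways: the algebra with involution is just the span of
  the identity and \<open>N\<close>, and every power of \<open>N\<close> lies in that span, its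
  contracted product being the same combination of the original product and the one contracted by
  \<open>N\<close>.\<close>

theorem corollary1:
  fixes A :: "('m::{t2_space,second_countable_topology}, 'e::real_inner, 'v::real_vector) courant"
    and N :: "'m \<Rightarrow> 'v \<Rightarrow> 'v"
  assumes "courant_algebroid A"
    and "irreducible_courant A"
    and "courant_nijenhuis_tensor A N"
  shows "\<exists>lam \<gamma> :: real.
      tens_add A N (adjoint_tensor A N) = tens_scale A lam (tens_id A) \<and>
      tens_add A (tens_add A (tens_comp A N N) (tens_scale A (- lam) N)) (tens_scale A \<gamma> (tens_id A))
        = tens_zero A \<and>
      involutive_algebra A N =
        {tens_add A (tens_scale A a (tens_id A)) (tens_scale A b N) | a b. True} \<and>
      (\<forall>k. \<exists>a b. tens_power A N k = tens_add A (tens_scale A a (tens_id A)) (tens_scale A b N) \<and>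
         (\<forall>X\<in>Sec A. \<forall>Y\<in>Sec A. contracted A (tens_power A N k) X Y =
            (\<lambda>p. a *\<^sub>R cprod A X Y p + b *\<^sub>R contracted A N X Y p)))"
proof -
  interpret courant_nijenhuis A N
    using assms by unfold_locales
  obtain l where l: "tens_add A N N' = tens_scale A l (tens_id A)"
    using trace_scalar[OF assms(2)] .
  obtain m where m: "tens_add A (tens_comp A N N) (tens_scale A (- l) N) = tens_scale A m (tens_id A)"
    using norm_scalar[OF l assms(2)] .
  \<comment> \<open>The constant \<open>\<gamma>\<close> is \<open>- m\<close>, with
    \<open>m\<close> the scalar found by the second use of irreducibility.\<close>
  have q: "tens_add A (tens_add A (tens_comp A N N) (tens_scale A (- l) N)) (tens_scale A (- m) (tens_id A))
      = tens_zero A"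
    unfolding m by (auto simp: tens_add_def tens_scale_def tens_id_def tens_zero_def cong: restrict_cong)
  have "\<exists>a b. tens_power A N k = lin a b \<and> (\<forall>X\<in>Sec A. \<forall>Y\<in>Sec A. contracted A (tens_power A N k) X Y =
      (\<lambda>p. a *\<^sub>R (X \<diamondop> Y) p + b *\<^sub>R contracted A N X Y p))" for k
  proof -
    obtain a b where "tens_power A N k = lin a b" using tens_power_eq[OF l q] by blast
    then show ?thesis using contracted_lin by auto
  qed
  then show ?thesis
    using l q involutive_algebra_eq[OF l q] unfolding lin_def
    by (intro exI[of _ l] exI[of _ "- m"]) simp
qed

end
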